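(* There exists an absolute constant $c>0$ such that for every prime power $q\equiv 3\bmod 4$, every set of points $A\subset\mathbb{F}_q^2$ and every set $R$ of rigid motions in $\mathbb{F}_q^2$, \[\left\vert \bigcup_{r\in R}\phi_r(A)\right\vert\ \ge\ c\,\min\left\lbrace q^2,\ \frac{|A|^{1/2}|R|}{q}\right\rbrace.\]
   Context: $\mathbb{F}_q$ is the finite field of order $q$. $O(2)$ is the group of $2\times 2$ orthogonal matrices over $\mathbb{F}_q$ ($g^Tg=I$). A rigid motion in $\mathbb{F}_q^2$ is a pair $r=(g,z)\in O(2)\times\mathbb{F}_q^2$, acting by $\phi_r(x):=gx+z$. *)

theory Defs
  imports
    "HOL-Analysis.Cartesian_Space"
    "HOL-Algebra.Weak_Morphisms"
    "HOL-Number_Theory.Prime_Powers"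
begin

text \<open>
  Vectors and matrices use the types \<open>'a ^ 'n\<close> and \<open>'a ^ 'n ^ 'm\<close> of HOL-Analysis, but arithmetic
  on entries is that of a ring \<open>F\<close> in the sense of HOL-Algebra: the finite fields have to range
  over a value rather than over a type, so that the constant in the theorem can be quantified
  before the field.
\<close>

definition vec_carrier :: "('a, 'b) ring_scheme \<Rightarrow> ('a ^ 'n) set" where
  "vec_carrier F = {x. \<forall>i. x $ i \<in> carrier F}"

definition mat_carrier :: "('a, 'b) ring_scheme \<Rightarrow> ('a ^ 'n ^ 'm) set" where
  "mat_carrier F = {g. \<forall>i j. g $ i $ j \<in> carrier F}"

definition vec_plus :: "('a, 'b) ring_scheme \<Rightarrow> 'a ^ 'n \<Rightarrow> 'a ^ 'n \<Rightarrow> 'a ^ 'n" where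
  "vec_plus F x y = (\<chi> i. x $ i \<oplus>\<^bsub>F\<^esub> y $ i)"

definition mat_vec_mult :: "('a, 'b) ring_scheme \<Rightarrow> 'a ^ 'n ^ 'm \<Rightarrow> 'a ^ 'n \<Rightarrow> 'a ^ 'm" where
  "mat_vec_mult F g x = (\<chi> i. \<Oplus>\<^bsub>F\<^esub>j\<in>UNIV. g $ i $ j \<otimes>\<^bsub>F\<^esub> x $ j)"

definition mat_mult :: "('a, 'b) ring_scheme \<Rightarrow> 'a ^ 'n ^ 'm \<Rightarrow> 'a ^ 'p ^ 'n \<Rightarrow> 'a ^ 'p ^ 'm" where
  "mat_mult F g h = (\<chi> i k. \<Oplus>\<^bsub>F\<^esub>j\<in>UNIV. g $ i $ j \<otimes>\<^bsub>F\<^esub> h $ j $ k)"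

definition mat_one :: "('a, 'b) ring_scheme \<Rightarrow> 'a ^ 'n ^ 'n" where
  "mat_one F = (\<chi> i j. if i = j then \<one>\<^bsub>F\<^esub> else \<zero>\<^bsub>F\<^esub>)"

definition orthogonal_group2 :: "('a, 'b) ring_scheme \<Rightarrow> ('a ^ 2 ^ 2) set" where
  "orthogonal_group2 F =
     {g \<in> mat_carrier F. mat_mult F (Finite_Cartesian_Product.transpose g) g = mat_one F}"

definition rigid_motions2 :: "('a, 'b) ring_scheme \<Rightarrow> (('a ^ 2 ^ 2) \<times> ('a ^ 2)) set" where
  "rigid_motions2 F = orthogonal_group2 F \<times> vec_carrier F"

definition motion_map ::
  "('a, 'b) ring_scheme \<Rightarrow> ('a ^ 2 ^ 2) \<times> ('a ^ 2) \<Rightarrow> 'a ^ 2 \<Rightarrow> 'a ^ 2" where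
  "motion_map F r x = vec_plus F (mat_vec_mult F (fst r) x) (snd r)"

text \<open>
  Every finite field, over whatever carrier type, has an isomorphic copy whose elements are
  natural numbers. Quantifying over \<open>F :: nat ring\<close> therefore covers all finite fields.
\<close>

lemma finite_field_nat_copy:
  fixes K :: "('a, 'b) ring_scheme"
  assumes "field K" and fin: "finite (carrier K)"
  shows "\<exists>(F :: nat ring) f. field F \<and> f \<in> ring_iso K F"
proof -
  obtain f :: "'a \<Rightarrow> nat" where "inj_on f (carrier K)"
    using finite_imp_inj_to_nat_seg[OF fin] by blast
  then show ?thesis
    using field.inj_imp_image_ring_is_field[OF assms(1)] inj_imp_image_ring_iso by blast
qed

end

theory Submission
  imports Defs "HOL-Analysis.Convex" "HOL-Algebra.Multiplicative_Group"
begin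

text \<open>
  Write \<open>B\<close> for the union of the images of \<open>A\<close>. A motion \<open>r\<close> of the given set maps all of \<open>A\<close> into \<open>B\<close>,
  whereas for a typical motion the number of points of \<open>A\<close> that land in \<open>B\<close> is close to the average
  \<open>|A| |B| / q\<^sup>2\<close>. If \<open>|B| < q\<^sup>2 / 2\<close>, every \<open>r\<close> therefore deviates from the average by more than \<open>|A| / 2\<close>,
  and a bound for the sum of the squared deviations over the whole group of motions limits how many
  such \<open>r\<close> there can be: it suffices that this sum is \<open>O(q |A|\<^bsup>3/2\<^esup> |B|)\<close> (\<open>motions_variance\<close>).

  For a fixed rotation, Plancherel in the translation variable (\<open>translate_variance\<close>) turns the
  sum of squared deviations into the sum of \<open>|fourier A (g\<^sup>T \<xi>)|\<^sup>2 |fourier B \<xi>|\<^sup>2\<close> over the nonzero frequencies, divided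
  by \<open>q\<^sup>2\<close>. As \<open>g\<close> runs through the orthogonal group, \<open>g\<^sup>T \<xi>\<close> meets each point of the circle through
  \<open>\<xi>\<close> at most twice (\<open>sum_orthogonal_orbit_le\<close>), so what is needed is a bound for the \<open>L\<^sup>2\<close> mass of
  \<open>fourier A\<close> on a circle. That is the finite field analogue of the Stein--Tomas restriction theorem
  (\<open>restriction_L2\<close>): by duality it follows from an \<open>L\<^sup>2 \<rightarrow> L\<^sup>4\<close> extension estimate (\<open>extension_L4\<close>), and the
  latter expresses that two points of a circle are determined up to order by their sum, unless
  the sum is zero (\<open>circle_sidon\<close>).

  The congruence condition on \<open>q\<close> says that \<open>-1\<close> is not a square
  (\<open>sum_of_squares_anisotropic\<close>). Hence \<open>x\<^sup>2 + y\<^sup>2\<close> vanishes only at the origin, so that no nonzero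
  frequency lies on a circle of radius zero; otherwise that circle would contain lines, and the Sidon
  property would fail.
\<close>

section \<open>Fourier analysis on a finite self-dual group\<close>

text \<open>
  In a Sidon set every product determines its two factors up to order. A set closed
  under inverses, such as a circle centred at the origin, has many pairs with product \<open>\<one>\<close>, so that
  this one product is exempt.
\<close>

definition sidon_off_one :: "('a, 'b) monoid_scheme \<Rightarrow> 'a set \<Rightarrow> bool" where
  "sidon_off_one G C \<longleftrightarrow> (\<forall>a\<in>C. \<forall>b\<in>C. \<forall>c\<in>C. \<forall>d\<in>C.
     a \<otimes>\<^bsub>G\<^esub> b = c \<otimes>\<^bsub>G\<^esub> d \<longrightarrow> a \<otimes>\<^bsub>G\<^esub> b \<noteq> \<one>\<^bsub>G\<^esub> \<longrightarrow> c = a \<or> c = b)"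

text \<open>
  The pairing \<open>e\<close> identifies a finite abelian group with its dual, so that points and frequencies
  live in the same group; the case of interest is \<open>e x \<xi> = \<psi> (x \<bullet> \<xi>)\<close> on the plane.
\<close>

locale self_dual_group = comm_group G for G (structure) +
  fixes e :: "'a \<Rightarrow> 'a \<Rightarrow> complex"
  assumes finite_carrier: "finite (carrier G)"
    and e_mult: "\<lbrakk>x \<in> carrier G; y \<in> carrier G; \<xi> \<in> carrier G\<rbrakk> \<Longrightarrow> e (x \<otimes> y) \<xi> = e x \<xi> * e y \<xi>"
    and e_commute: "\<lbrakk>x \<in> carrier G; \<xi> \<in> carrier G\<rbrakk> \<Longrightarrow> e x \<xi> = e \<xi> x"
    and norm_e: "\<lbrakk>x \<in> carrier G; \<xi> \<in> carrier G\<rbrakk> \<Longrightarrow> cmod (e x \<xi>) = 1"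
    and nondegenerate: "\<lbrakk>x \<in> carrier G; x \<noteq> \<one>\<rbrakk> \<Longrightarrow> \<exists>\<xi>\<in>carrier G. e x \<xi> \<noteq> 1"
begin

lemma e_mult_right:
  "\<lbrakk>x \<in> carrier G; \<xi> \<in> carrier G; \<eta> \<in> carrier G\<rbrakk> \<Longrightarrow> e x (\<xi> \<otimes> \<eta>) = e x \<xi> * e x \<eta>"
  by (metis e_commute e_mult m_closed)

lemma e_one: "\<xi> \<in> carrier G \<Longrightarrow> e \<one> \<xi> = 1"
  by (metis e_mult l_one mult_cancel_left1 norm_e norm_zero one_closed zero_neq_one)

lemma e_inv:
  assumes "x \<in> carrier G" "\<xi> \<in> carrier G"
  shows "e (inv x) \<xi> = cnj (e x \<xi>)"
proof -
  have "e (inv x) \<xi> * e x \<xi> = 1"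
    using assms e_mult[of "inv x" x \<xi>] by (simp add: e_one)
  moreover have "cnj (e x \<xi>) * e x \<xi> = 1"
    using norm_e[OF assms] complex_norm_square[of "e x \<xi>"] by (simp add: mult.commute)
  ultimately show ?thesis
    by (metis mult_cancel_right mult_zero_right zero_neq_one)
qed

lemma character_sum:
  assumes x: "x \<in> carrier G"
  shows "(\<Sum>\<xi>\<in>carrier G. e x \<xi>) = (if x = \<one> then of_nat (order G) else 0)"
proof (cases "x = \<one>")
  case True
  then show ?thesis by (simp add: e_one order_def)
next
  case False
  then obtain \<eta> where \<eta>: "\<eta> \<in> carrier G" "e x \<eta> \<noteq> 1"
    using nondegenerate x by blast
  have "(\<Sum>\<xi>\<in>carrier G. e x \<xi>) = (\<Sum>\<xi>\<in>carrier G. e x (\<eta> \<otimes> \<xi>))"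
    using x \<eta> by (intro sum.reindex_bij_witness[of _ "\<lambda>\<xi>. \<eta> \<otimes> \<xi>" "\<lambda>\<xi>. inv \<eta> \<otimes> \<xi>"])
      (auto simp flip: m_assoc)
  also have "\<dots> = e x \<eta> * (\<Sum>\<xi>\<in>carrier G. e x \<xi>)"
    using x \<eta> by (simp add: e_mult_right sum_distrib_left)
  finally show ?thesis using \<eta> False by simp
qed

text \<open>
  Expanding the square and summing over \<open>x\<close> first leaves only the diagonal, by orthogonality of the
  characters \<open>e \<xi>\<close>.
\<close>

lemma plancherel:
  "(\<Sum>x\<in>carrier G. (cmod (\<Sum>\<xi>\<in>carrier G. c \<xi> * e x \<xi>))\<^sup>2)
    = order G * (\<Sum>\<xi>\<in>carrier G. (cmod (c \<xi>))\<^sup>2)"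
proof -
  have orth: "(\<Sum>x\<in>carrier G. e x \<xi> * cnj (e x \<eta>)) = (if \<xi> = \<eta> then of_nat (order G) else 0)"
    if "\<xi> \<in> carrier G" "\<eta> \<in> carrier G" for \<xi> \<eta>
  proof -
    have "(\<Sum>x\<in>carrier G. e x \<xi> * cnj (e x \<eta>)) = (\<Sum>x\<in>carrier G. e (\<xi> \<otimes> inv \<eta>) x)"
      using that by (intro sum.cong) (auto simp: e_mult e_inv e_commute[of \<xi>] e_commute[of \<eta>])
    also have "\<dots> = (if \<xi> \<otimes> inv \<eta> = \<one> then of_nat (order G) else 0)"
      using that by (intro character_sum) simp
    also have "\<xi> \<otimes> inv \<eta> = \<one> \<longleftrightarrow> \<xi> = \<eta>"
      using that by (metis inv_closed inv_equality inv_inv r_inv)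
    finally show ?thesis .
  qed
  have "complex_of_real (\<Sum>x\<in>carrier G. (cmod (\<Sum>\<xi>\<in>carrier G. c \<xi> * e x \<xi>))\<^sup>2)
      = (\<Sum>x\<in>carrier G. \<Sum>\<xi>\<in>carrier G. \<Sum>\<eta>\<in>carrier G.
           c \<xi> * cnj (c \<eta>) * (e x \<xi> * cnj (e x \<eta>)))"
    by (simp add: complex_norm_square sum_product mult_ac del: of_real_power)
  also have "\<dots> = (\<Sum>\<xi>\<in>carrier G. \<Sum>x\<in>carrier G. \<Sum>\<eta>\<in>carrier G.
           c \<xi> * cnj (c \<eta>) * (e x \<xi> * cnj (e x \<eta>)))"
    by (rule sum.swap)
  also have "\<dots> = (\<Sum>\<xi>\<in>carrier G. \<Sum>\<eta>\<in>carrier G. \<Sum>x\<in>carrier G.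
           c \<xi> * cnj (c \<eta>) * (e x \<xi> * cnj (e x \<eta>)))"
    by (intro sum.cong refl sum.swap)
  also have "\<dots> = (\<Sum>\<xi>\<in>carrier G. \<Sum>\<eta>\<in>carrier G.
           if \<xi> = \<eta> then c \<xi> * cnj (c \<xi>) * of_nat (order G) else 0)"
    by (intro sum.cong refl) (simp add: orth flip: sum_distrib_left)
  also have "\<dots> = (\<Sum>\<xi>\<in>carrier G. c \<xi> * cnj (c \<xi>) * of_nat (order G))"
    using finite_carrier by simp
  also have "\<dots> = complex_of_real (order G * (\<Sum>\<xi>\<in>carrier G. (cmod (c \<xi>))\<^sup>2))"
    by (simp add: complex_norm_square sum_distrib_left mult_ac del: of_real_power)
  finally show ?thesis by (simp only: of_real_eq_iff)
qed

definition fourier :: "'a set \<Rightarrow> 'a \<Rightarrow> complex" where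
  "fourier A \<xi> = (\<Sum>a\<in>A. e a \<xi>)"

lemma parseval:
  assumes "B \<subseteq> carrier G"
  shows "(\<Sum>\<xi>\<in>carrier G. (cmod (fourier B \<xi>))\<^sup>2) = order G * card B"
proof -
  have "fourier B \<xi> = (\<Sum>b\<in>carrier G. of_bool (b \<in> B) * e \<xi> b)" if "\<xi> \<in> carrier G" for \<xi>
    using assms finite_carrier that unfolding fourier_def
    by (intro sum.mono_neutral_cong_left) (auto simp: e_commute)
  then have "(\<Sum>\<xi>\<in>carrier G. (cmod (fourier B \<xi>))\<^sup>2)
      = order G * (\<Sum>b\<in>carrier G. (cmod (of_bool (b \<in> B)))\<^sup>2)"
    by (simp add: plancherel[symmetric])
  also have "(\<Sum>b\<in>carrier G. (cmod (of_bool (b \<in> B)))\<^sup>2) = (\<Sum>b\<in>B. 1)"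
    using assms finite_carrier by (intro sum.mono_neutral_cong_right) auto
  finally show ?thesis by simp
qed

text \<open>
  The number of \<open>a \<in> A\<close> with \<open>a \<otimes> z \<in> B\<close> is a correlation of the indicator functions, whose Fourier
  transform in \<open>z\<close> is, up to conjugation, the product of the two transforms. The trivial
  frequency contributes the average over \<open>z\<close>, which is what the left-hand side subtracts.
\<close>

lemma translate_variance:
  assumes A: "A \<subseteq> carrier G" and B: "B \<subseteq> carrier G"
  shows "(\<Sum>z\<in>carrier G. (card {a \<in> A. a \<otimes> z \<in> B} - card A * card B / order G)\<^sup>2)
    = (\<Sum>\<xi>\<in>carrier G - {\<one>}. (cmod (fourier A \<xi>))\<^sup>2 * (cmod (fourier B \<xi>))\<^sup>2) / order G"
proof -
  have fin: "finite A" "finite B" using A B finite_carrier finite_subset by auto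
  have o: "order G > 0" using finite_carrier by (simp add: order_gt_0_iff_finite)
  \<comment> \<open>Dropping the trivial frequency from the expansion of the count subtracts the average.\<close>
  define c where "c \<xi> = (if \<xi> = \<one> then 0 else fourier A \<xi> * cnj (fourier B \<xi>) / order G)" for \<xi>
  have *: "complex_of_real (card {a \<in> A. a \<otimes> z \<in> B} - card A * card B / order G)
      = (\<Sum>\<xi>\<in>carrier G. c \<xi> * e z \<xi>)" if z: "z \<in> carrier G" for z
  proof -
    have 1: "(\<Sum>\<xi>\<in>carrier G. e (a \<otimes> z \<otimes> inv b) \<xi>) = (if b = a \<otimes> z then of_nat (order G) else 0)"
      if "a \<in> A" "b \<in> B" for a b
    proof -
      have "a \<in> carrier G" "b \<in> carrier G" using that A B by auto
      then have "a \<otimes> z \<otimes> inv b = \<one> \<longleftrightarrow> b = a \<otimes> z"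
        using z by (metis inv_closed inv_equality inv_inv m_closed r_inv)
      then show ?thesis
        using \<open>a \<in> carrier G\<close> \<open>b \<in> carrier G\<close> z by (simp add: character_sum)
    qed
    have "of_nat (card {a \<in> A. a \<otimes> z \<in> B}) * complex_of_nat (order G)
        = (\<Sum>a\<in>A. if a \<otimes> z \<in> B then of_nat (order G) else 0)"
      using fin by (simp add: sum.If_cases Int_def)
    also have "\<dots> = (\<Sum>a\<in>A. \<Sum>b\<in>B. \<Sum>\<xi>\<in>carrier G. e (a \<otimes> z \<otimes> inv b) \<xi>)"
      using fin by (intro sum.cong refl) (simp add: 1)
    also have "\<dots> = (\<Sum>a\<in>A. \<Sum>b\<in>B. \<Sum>\<xi>\<in>carrier G. e a \<xi> * cnj (e b \<xi>) * e z \<xi>)"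
      using A B z by (intro sum.cong refl) (simp add: e_mult e_inv subset_eq)
    also have "\<dots> = (\<Sum>a\<in>A. \<Sum>\<xi>\<in>carrier G. \<Sum>b\<in>B. e a \<xi> * cnj (e b \<xi>) * e z \<xi>)"
      by (intro sum.cong refl sum.swap)
    also have "\<dots> = (\<Sum>\<xi>\<in>carrier G. \<Sum>a\<in>A. \<Sum>b\<in>B. e a \<xi> * cnj (e b \<xi>) * e z \<xi>)"
      by (rule sum.swap)
    also have "\<dots> = (\<Sum>\<xi>\<in>carrier G. fourier A \<xi> * cnj (fourier B \<xi>) * e z \<xi>)"
      by (simp add: fourier_def sum_product flip: sum_distrib_right)
    also have "\<dots> = card A * card B
        + (\<Sum>\<xi>\<in>carrier G - {\<one>}. fourier A \<xi> * cnj (fourier B \<xi>) * e z \<xi>)"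
    proof -
      have "e a \<one> = 1" if "a \<in> carrier G" for a
        using that e_one by (simp add: e_commute)
      then have "fourier A \<one> = card A" "fourier B \<one> = card B" "e z \<one> = 1"
        using A B z by (simp_all add: fourier_def subset_eq)
      then show ?thesis
        using finite_carrier by (subst sum.remove[of _ \<one>]) auto
    qed
    also have "(\<Sum>\<xi>\<in>carrier G - {\<one>}. fourier A \<xi> * cnj (fourier B \<xi>) * e z \<xi>)
        = (\<Sum>\<xi>\<in>carrier G. c \<xi> * e z \<xi>) * order G"
      unfolding sum_distrib_right using finite_carrier o
      by (intro sum.mono_neutral_cong_left) (auto simp: c_def)
    finally show ?thesis using o by (simp add: field_simps)
  qed
  have "(\<Sum>z\<in>carrier G. (card {a \<in> A. a \<otimes> z \<in> B} - card A * card B / order G)\<^sup>2)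
      = (\<Sum>z\<in>carrier G. (cmod (\<Sum>\<xi>\<in>carrier G. c \<xi> * e z \<xi>))\<^sup>2)"
    by (intro sum.cong refl) (simp flip: * del: of_real_diff)
  also have "\<dots> = order G * (\<Sum>\<xi>\<in>carrier G. (cmod (c \<xi>))\<^sup>2)"
    by (rule plancherel)
  also have "(\<Sum>\<xi>\<in>carrier G. (cmod (c \<xi>))\<^sup>2)
      = (\<Sum>\<xi>\<in>carrier G - {\<one>}. (cmod (fourier A \<xi>))\<^sup>2 * (cmod (fourier B \<xi>))\<^sup>2 / (real (order G))\<^sup>2)"
    using finite_carrier
    by (intro sum.mono_neutral_cong_right)
      (auto simp: c_def norm_mult norm_divide power_mult_distrib power_divide)
  finally show ?thesis
    using o by (simp add: power2_eq_square field_simps flip: sum_divide_distrib)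
qed

text \<open>
  The square of the extension \<open>E x = (\<Sum>\<xi>\<in>C. f \<xi> * e x \<xi>)\<close> is again an exponential sum, with coefficient
  at \<open>s\<close> the sum \<open>h s\<close> of \<open>f \<xi> * f \<eta>\<close> over \<open>\<xi> \<otimes> \<eta> = s\<close>. By Plancherel the fourth moment of \<open>E\<close> is
  \<open>order G\<close> times the squared \<open>L\<^sup>2\<close> norm of \<open>h\<close>. Away from \<open>s = \<one>\<close> at most two terms
  occur in \<open>h s\<close>, which costs a factor 2; at \<open>s = \<one>\<close> each \<open>\<xi>\<close> has at most one partner, and the Cauchy--Schwarz inequality costs a factor 1.
\<close>

lemma extension_L4:
  assumes C: "C \<subseteq> carrier G" and sidon: "sidon_off_one G C"
  shows "(\<Sum>x\<in>carrier G. (cmod (\<Sum>\<xi>\<in>C. f \<xi> * e x \<xi>)) ^ 4)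
    \<le> 3 * order G * (\<Sum>\<xi>\<in>C. (cmod (f \<xi>))\<^sup>2)\<^sup>2"
proof -
  have finC: "finite C" using C finite_carrier finite_subset by auto
  define T where "T = (\<Sum>\<xi>\<in>C. (cmod (f \<xi>))\<^sup>2)"
  define P where "P s = {p \<in> C \<times> C. fst p \<otimes> snd p = s}" for s
  define h where "h s = (\<Sum>p\<in>P s. f (fst p) * f (snd p))" for s
  define w where "w s = (\<Sum>p\<in>P s. (cmod (f (fst p)))\<^sup>2 * (cmod (f (snd p)))\<^sup>2)" for s
  have finP: "finite (P s)" for s unfolding P_def using finC by auto
  have P_image: "(\<lambda>p. fst p \<otimes> snd p) ` (C \<times> C) \<subseteq> carrier G"
    using C by (auto simp: subset_eq)
  note group_by_sum = sum.group[OF finite_cartesian_product[OF finC finC] finite_carrier P_image,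
      folded P_def]
  have wT: "(\<Sum>s\<in>carrier G. w s) = T\<^sup>2"
    unfolding w_def group_by_sum T_def power2_eq_square[of "sum _ _"] sum_product
    by (simp add: sum.cartesian_product case_prod_beta)
  have cauchy: "(cmod (\<Sum>p\<in>Q. u p * v p))\<^sup>2 \<le> (\<Sum>p\<in>Q. (cmod (u p))\<^sup>2) * (\<Sum>p\<in>Q. (cmod (v p))\<^sup>2)"
    for Q and u v :: "'a \<times> 'a \<Rightarrow> complex"
  proof -
    have "(cmod (\<Sum>p\<in>Q. u p * v p))\<^sup>2 \<le> (\<Sum>p\<in>Q. cmod (u p) * cmod (v p))\<^sup>2"
      by (intro power_mono sum_norm_le) (auto simp: norm_mult)
    also have "\<dots> \<le> (\<Sum>p\<in>Q. (cmod (u p))\<^sup>2) * (\<Sum>p\<in>Q. (cmod (v p))\<^sup>2)"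
      by (rule Cauchy_Schwarz_ineq_sum)
    finally show ?thesis .
  qed
  have h_le: "(cmod (h s))\<^sup>2 \<le> 2 * w s" if "s \<in> carrier G" "s \<noteq> \<one>" for s
  proof -
    have "card (P s) \<le> 2"
    proof (cases "P s = {}")
      case False
      then obtain a b where ab: "(a, b) \<in> P s" by auto
      have "p \<in> {(a, b), (b, a)}" if p: "p \<in> P s" for p
      proof -
        obtain c d where cd: "p = (c, d)" by force
        have cl: "a \<in> carrier G" "b \<in> carrier G" "c \<in> carrier G" "d \<in> carrier G"
          using ab p C unfolding P_def cd by auto
        have eq: "a \<otimes> b = c \<otimes> d" using ab p unfolding P_def cd by auto
        have mem: "a \<in> C" "b \<in> C" "c \<in> C" "d \<in> C" and "a \<otimes> b \<noteq> \<one>"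
          using ab p \<open>s \<noteq> \<one>\<close> unfolding P_def cd by auto
        then have "c = a \<or> c = b"
          using sidon eq unfolding sidon_off_one_def by blast
        then show ?thesis
          using eq cl m_comm[of a b] unfolding cd by auto
      qed
      then have "card (P s) \<le> card {(a, b), (b, a)}" by (intro card_mono) auto
      also have "\<dots> \<le> 2" by (intro card_insert_le_m1) auto
      finally show ?thesis .
    qed simp
    have "(cmod (h s))\<^sup>2 \<le> (\<Sum>p\<in>P s. (cmod 1)\<^sup>2) * (\<Sum>p\<in>P s. (cmod (f (fst p) * f (snd p)))\<^sup>2)"
      unfolding h_def using cauchy[of "\<lambda>_. 1"] by simp
    also have "\<dots> = card (P s) * w s"
      unfolding w_def by (simp add: norm_mult power_mult_distrib)
    also have "\<dots> \<le> 2 * w s"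
      using \<open>card (P s) \<le> 2\<close> by (intro mult_right_mono) (auto simp: w_def intro: sum_nonneg)
    finally show ?thesis .
  qed
  have h_one: "(cmod (h \<one>))\<^sup>2 \<le> T\<^sup>2"
  proof -
    have proj: "(\<Sum>p\<in>P \<one>. (cmod (f (\<pi> p)))\<^sup>2) \<le> T" if "\<pi> = fst \<or> \<pi> = snd" for \<pi>
    proof -
      have inj: "inj_on \<pi> (P \<one>)"
      proof (rule inj_onI)
        fix p p' assume p: "p \<in> P \<one>" and p': "p' \<in> P \<one>" and "\<pi> p = \<pi> p'"
        have fst_snd: "fst r \<in> carrier G" "snd r \<in> carrier G" "fst r = inv (snd r)"
          if "r \<in> P \<one>" for r
          using that C unfolding P_def by (auto simp: subset_eq inv_equality)
        show "p = p'"
          using that \<open>\<pi> p = \<pi> p'\<close> fst_snd[OF p] fst_snd[OF p']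
          by (metis inv_inv prod_eqI)
      qed
      have "(\<Sum>p\<in>P \<one>. (cmod (f (\<pi> p)))\<^sup>2) = (\<Sum>\<xi>\<in>\<pi> ` P \<one>. (cmod (f \<xi>))\<^sup>2)"
        using inj by (simp add: sum.reindex)
      also have "\<dots> \<le> T"
        unfolding T_def using finC that by (intro sum_mono2) (auto simp: P_def)
      finally show ?thesis .
    qed
    have "(cmod (h \<one>))\<^sup>2 \<le> (\<Sum>p\<in>P \<one>. (cmod (f (fst p)))\<^sup>2) * (\<Sum>p\<in>P \<one>. (cmod (f (snd p)))\<^sup>2)"
      unfolding h_def by (rule cauchy)
    also have "\<dots> \<le> T * T"
      by (intro mult_mono proj) (auto simp: T_def intro: sum_nonneg)
    finally show ?thesis by (simp add: power2_eq_square)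
  qed
  have square: "(\<Sum>\<xi>\<in>C. f \<xi> * e x \<xi>)\<^sup>2 = (\<Sum>s\<in>carrier G. h s * e x s)" if x: "x \<in> carrier G" for x
  proof -
    have "(\<Sum>\<xi>\<in>C. f \<xi> * e x \<xi>)\<^sup>2
        = (\<Sum>p\<in>C \<times> C. f (fst p) * f (snd p) * e x (fst p \<otimes> snd p))"
      unfolding power2_eq_square sum_product sum.cartesian_product using x C
      by (intro sum.cong refl) (auto simp: e_mult_right subset_eq)
    also have "\<dots> = (\<Sum>s\<in>carrier G. h s * e x s)"
      unfolding group_by_sum[symmetric] h_def sum_distrib_right
      by (intro sum.cong refl) (auto simp: P_def)
    finally show ?thesis .
  qed
  have "(\<Sum>x\<in>carrier G. (cmod (\<Sum>\<xi>\<in>C. f \<xi> * e x \<xi>)) ^ 4)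
      = (\<Sum>x\<in>carrier G. (cmod (\<Sum>s\<in>carrier G. h s * e x s))\<^sup>2)"
    by (intro sum.cong refl) (simp add: norm_power flip: square)
  also have "\<dots> = order G * (\<Sum>s\<in>carrier G. (cmod (h s))\<^sup>2)"
    by (rule plancherel)
  also have "\<dots> \<le> order G * (3 * T\<^sup>2)"
  proof (intro mult_left_mono)
    have "(\<Sum>s\<in>carrier G. (cmod (h s))\<^sup>2) = (cmod (h \<one>))\<^sup>2 + (\<Sum>s\<in>carrier G - {\<one>}. (cmod (h s))\<^sup>2)"
      using finite_carrier by (intro sum.remove) auto
    also have "\<dots> \<le> T\<^sup>2 + (\<Sum>s\<in>carrier G - {\<one>}. 2 * w s)"
      by (intro add_mono h_one sum_mono h_le) auto
    also have "(\<Sum>s\<in>carrier G - {\<one>}. 2 * w s) \<le> (\<Sum>s\<in>carrier G. 2 * w s)"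
      using finite_carrier by (intro sum_mono2) (auto simp: w_def intro!: sum_nonneg)
    also have "\<dots> = 2 * T\<^sup>2" by (simp add: wT flip: sum_distrib_left)
    finally show "(\<Sum>s\<in>carrier G. (cmod (h s))\<^sup>2) \<le> 3 * T\<^sup>2" by simp
  qed simp
  finally show ?thesis unfolding T_def by (simp add: mult_ac)
qed

text \<open>
  With \<open>T\<close> the sum on the left before squaring, \<open>T\<close> is the sum over \<open>A\<close> of the extension \<open>E\<close> of
  the conjugate of \<open>fourier A\<close>. Hoelder's inequality with exponents 4/3 and 4, in the form of
  two applications of the Cauchy--Schwarz inequality, bounds \<open>T\<^sup>4\<close> by \<open>|A|\<^sup>3\<close> times the fourth moment of \<open>E\<close>, hence
  by a constant times \<open>T\<^sup>2\<close>.
\<close>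

lemma restriction_L2:
  assumes A: "A \<subseteq> carrier G" and C: "C \<subseteq> carrier G" and sidon: "sidon_off_one G C"
  shows "(\<Sum>\<xi>\<in>C. (cmod (fourier A \<xi>))\<^sup>2)\<^sup>2 \<le> 3 * order G * real (card A) ^ 3"
proof -
  define T where "T = (\<Sum>\<xi>\<in>C. (cmod (fourier A \<xi>))\<^sup>2)"
  define E where "E x = cmod (\<Sum>\<xi>\<in>C. cnj (fourier A \<xi>) * e x \<xi>)" for x
  have finA: "finite A" using A finite_carrier finite_subset by auto
  have T0: "T \<ge> 0" unfolding T_def by (intro sum_nonneg) auto
  have "complex_of_real T = (\<Sum>\<xi>\<in>C. cnj (fourier A \<xi>) * (\<Sum>a\<in>A. e a \<xi>))"
    unfolding T_def by (simp add: complex_norm_square mult.commute fourier_def del: of_real_power)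
  also have "\<dots> = (\<Sum>a\<in>A. \<Sum>\<xi>\<in>C. cnj (fourier A \<xi>) * e a \<xi>)"
    unfolding sum_distrib_left by (rule sum.swap)
  finally have T_eq: "complex_of_real T = (\<Sum>a\<in>A. \<Sum>\<xi>\<in>C. cnj (fourier A \<xi>) * e a \<xi>)" .
  have "T = cmod (complex_of_real T)" using T0 by simp
  also have "\<dots> \<le> (\<Sum>a\<in>A. E a)" unfolding T_eq E_def by (rule norm_sum)
  finally have "T \<le> (\<Sum>a\<in>A. E a)" .
  then have "T ^ 4 \<le> ((\<Sum>a\<in>A. E a)\<^sup>2)\<^sup>2"
    using T0 by (simp add: power_mono)
  also have "\<dots> \<le> (card A * (\<Sum>a\<in>A. (E a)\<^sup>2))\<^sup>2"
    using sum_squared_le_sum_of_squares[of E A] by (intro power_mono) (auto simp: mult.commute)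
  also have "\<dots> = (real (card A))\<^sup>2 * (\<Sum>a\<in>A. (E a)\<^sup>2)\<^sup>2"
    by (simp add: power_mult_distrib)
  also have "\<dots> \<le> (real (card A))\<^sup>2 * (card A * (\<Sum>a\<in>A. ((E a)\<^sup>2)\<^sup>2))"
    using sum_squared_le_sum_of_squares[of "\<lambda>a. (E a)\<^sup>2" A]
    by (intro mult_left_mono) (auto simp: mult.commute)
  also have "\<dots> = real (card A) ^ 3 * (\<Sum>a\<in>A. (E a) ^ 4)"
    by (simp add: power2_eq_square power3_eq_cube power4_eq_xxxx mult_ac)
  also have "\<dots> \<le> real (card A) ^ 3 * (\<Sum>a\<in>carrier G. (E a) ^ 4)"
    using A finite_carrier by (intro mult_left_mono sum_mono2) auto
  also have "\<dots> \<le> real (card A) ^ 3 * (3 * order G * T\<^sup>2)"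
    unfolding E_def T_def using extension_L4[OF C sidon, of "\<lambda>\<xi>. cnj (fourier A \<xi>)"]
    by (intro mult_left_mono) auto
  finally have "T\<^sup>2 * T\<^sup>2 \<le> (3 * order G * real (card A) ^ 3) * T\<^sup>2"
    by (simp add: mult_ac flip: power_add)
  then have "T\<^sup>2 \<le> 3 * order G * real (card A) ^ 3"
    using mult_right_le_imp_le[of "T\<^sup>2" "T\<^sup>2"] by (cases "T = 0") auto
  then show ?thesis unfolding T_def .
qed

end

section \<open>Characters, and square roots of -1\<close>

text \<open>
  Let \<open>H\<close> be a maximal proper subgroup and \<open>u \<notin> H\<close>. By maximality every element has the form
  \<open>h \<otimes> u [^] k\<close> with \<open>h \<in> H\<close>, so the quotient by \<open>H\<close> is cyclic, of order \<open>m\<close> say, and sending \<open>h \<otimes> u [^] k\<close> to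
  \<open>exp (2 \<pi> \<i> k / m)\<close> is a character.
\<close>

lemma (in comm_group) nontrivial_character_exists:
  assumes fin: "finite (carrier G)" and nontrivial: "carrier G \<noteq> {\<one>}"
  shows "\<exists>\<psi> :: 'a \<Rightarrow> complex.
    (\<forall>x\<in>carrier G. \<forall>y\<in>carrier G. \<psi> (x \<otimes> y) = \<psi> x * \<psi> y) \<and>
    (\<forall>x\<in>carrier G. cmod (\<psi> x) = 1) \<and> (\<exists>x\<in>carrier G. \<psi> x \<noteq> 1)"
proof -
  define S where "S = {H. subgroup H G \<and> H \<noteq> carrier G}"
  have "S \<subseteq> Pow (carrier G)" unfolding S_def using subgroup.subset by blast
  then have "finite S" using fin finite_subset by blast
  moreover have "{\<one>} \<in> S" unfolding S_def using triv_subgroup nontrivial by auto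
  ultimately obtain H where H: "H \<in> S" and Hmax: "\<And>K. K \<in> S \<Longrightarrow> H \<subseteq> K \<Longrightarrow> H = K"
    using finite_has_maximal[of S] by blast
  have sub: "subgroup H G" and "H \<noteq> carrier G" using H unfolding S_def by auto
  then obtain u where u: "u \<in> carrier G" "u \<notin> H" using subgroup.subset by blast
  have Hc: "h \<in> carrier G" if "h \<in> H" for h using sub that subgroup.subset by blast
  define K where "K = {h \<otimes> u [^] k | h (k :: int). h \<in> H}"
  have KI: "h \<otimes> u [^] k \<in> K" if "h \<in> H" for h and k :: int using that unfolding K_def by auto
  have "subgroup K G"
  proof (rule subgroupI)
    show "K \<subseteq> carrier G" unfolding K_def using u Hc by auto
    show "K \<noteq> {}" using KI subgroup.one_closed[OF sub] by blast
    show "inv x \<in> K" if x: "x \<in> K" for x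
    proof -
      obtain h k where h: "h \<in> H" and hk: "x = h \<otimes> u [^] (k :: int)" using x unfolding K_def by auto
      have "inv x = inv h \<otimes> u [^] (- k)"
        using h Hc u unfolding hk by (simp add: inv_mult int_pow_neg)
      then show ?thesis using KI subgroup.m_inv_closed[OF sub h] by simp
    qed
    show "x \<otimes> y \<in> K" if x: "x \<in> K" and y: "y \<in> K" for x y
    proof -
      obtain h k where h: "h \<in> H" and hk: "x = h \<otimes> u [^] (k :: int)" using x unfolding K_def by auto
      obtain h' k' where h': "h' \<in> H" and hk': "y = h' \<otimes> u [^] (k' :: int)" using y unfolding K_def by auto
      have "x \<otimes> y = (h \<otimes> h') \<otimes> u [^] (k + k')"
        using h h' Hc u unfolding hk hk' by (simp add: int_pow_mult m_ac)
      then show ?thesis using KI subgroup.m_closed[OF sub h h'] by simp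
    qed
  qed
  moreover have "H \<subseteq> K" using KI[of _ 0] Hc by force
  moreover have "u \<in> K" using KI[of \<one> 1] subgroup.one_closed[OF sub] u by simp
  ultimately have K: "K = carrier G" using Hmax u unfolding S_def by blast
  \<comment> \<open>The order of \<open>u\<close> modulo \<open>H\<close>.\<close>
  define m where "m = (LEAST m. 0 < m \<and> u [^] (m :: nat) \<in> H)"
  have "0 < order G \<and> u [^] order G \<in> H"
    using fin u subgroup.one_closed[OF sub] by (simp add: order_gt_0_iff_finite pow_order_eq_1)
  then have m: "0 < m" "u [^] m \<in> H"
    unfolding m_def by (metis (mono_tags, lifting) LeastI)+
  have min: "u [^] k \<notin> H" if "0 < k" "k < m" for k :: nat
    using that not_less_Least[of k "\<lambda>m. 0 < m \<and> u [^] (m :: nat) \<in> H"] unfolding m_def by auto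
  have "m \<noteq> 1" using m u by auto
  have dvd: "int m dvd k" if k: "u [^] k \<in> H" for k :: int
  proof -
    have "u [^] k \<otimes> inv ((u [^] int m) [^] (k div int m)) \<in> H"
      using k m sub by (simp add: int_pow_int subgroup.m_closed subgroup.m_inv_closed
          subgroup_int_pow_closed)
    also have "u [^] k \<otimes> inv ((u [^] int m) [^] (k div int m)) = u [^] (k mod int m)"
      using u by (simp add: int_pow_pow int_pow_diff[symmetric] minus_mult_div_eq_mod)
    also have "\<dots> = u [^] nat (k mod int m)"
      using m by (simp flip: int_pow_int)
    finally have "\<not> 0 < nat (k mod int m)"
      using min[of "nat (k mod int m)"] m by (auto simp: nat_less_iff)
    moreover have "k mod int m \<ge> 0" using m by simp
    ultimately show ?thesis by (simp add: dvd_eq_mod_eq_0)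
  qed
  define \<psi> where "\<psi> x = cis (2 * pi * real_of_int (SOME k. \<exists>h\<in>H. x = h \<otimes> u [^] k) / m)" for x
  have \<psi>: "\<psi> (h \<otimes> u [^] k) = cis (2 * pi * real_of_int k / m)" if h: "h \<in> H" for h k
  proof -
    define k' where "k' = (SOME k'. \<exists>h'\<in>H. h \<otimes> u [^] k = h' \<otimes> u [^] (k' :: int))"
    have "\<exists>h'\<in>H. h \<otimes> u [^] k = h' \<otimes> u [^] k'"
      unfolding k'_def by (rule someI[of _ k]) (use h in blast)
    then obtain h' where h': "h' \<in> H" "h \<otimes> u [^] k = h' \<otimes> u [^] k'" by blast
    have "u [^] (k - k') = inv h \<otimes> (h \<otimes> u [^] k) \<otimes> inv (u [^] k')"
      using Hc[OF h] u by (simp add: int_pow_diff flip: m_assoc)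
    also have "\<dots> = inv h \<otimes> h'"
      unfolding h'(2) using Hc[OF h] Hc[OF h'(1)] u by (simp add: m_assoc)
    finally have "u [^] (k - k') \<in> H"
      using h h' sub by (simp add: subgroup.m_closed subgroup.m_inv_closed)
    then obtain j where j: "k = k' + int m * j" using dvd by (metis dvdE diff_add_cancel add.commute)
    have "cis (2 * pi * real_of_int k / m) = cis (2 * pi * real_of_int k' / m + 2 * pi * real_of_int j)"
      using m unfolding j by (simp add: field_simps)
    also have "\<dots> = cis (2 * pi * real_of_int k' / m)"
      by (simp add: cis_mult[symmetric])
    finally show ?thesis unfolding \<psi>_def k'_def by simp
  qed
  show ?thesis
  proof (intro exI conjI ballI)
    show "\<psi> (x \<otimes> y) = \<psi> x * \<psi> y" if x: "x \<in> carrier G" and y: "y \<in> carrier G" for x y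
    proof -
      obtain h k where h: "h \<in> H" and hk: "x = h \<otimes> u [^] (k :: int)" using x unfolding K[symmetric] K_def by auto
      obtain h' k' where h': "h' \<in> H" and hk': "y = h' \<otimes> u [^] (k' :: int)" using y unfolding K[symmetric] K_def by auto
      have "x \<otimes> y = (h \<otimes> h') \<otimes> u [^] (k + k')"
        using h h' Hc u unfolding hk hk' by (simp add: int_pow_mult m_ac)
      then have "\<psi> (x \<otimes> y) = cis (2 * pi * real_of_int (k + k') / m)"
        using subgroup.m_closed[OF sub h h'] \<psi> by simp
      also have "\<dots> = \<psi> x * \<psi> y"
        unfolding hk hk' \<psi>[OF h] \<psi>[OF h'] by (simp add: cis_mult ring_distribs add_divide_distrib)
      finally show ?thesis .
    qed
    show "cmod (\<psi> x) = 1" if "x \<in> carrier G" for x unfolding \<psi>_def by simp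
    have "\<psi> u \<noteq> 1"
    proof
      assume "\<psi> u = 1"
      moreover have "\<psi> u = cis (2 * pi / m)"
        using \<psi>[of \<one> 1] subgroup.one_closed[OF sub] u by simp
      ultimately have "cos (2 * pi / m) = 1" by (metis cis.sel(1) one_complex.sel(1))
      then obtain n :: int where "2 * pi / m = real_of_int n * 2 * pi"
        unfolding cos_one_2pi_int by blast
      then have "real_of_int (n * int m) = 1" using m by (simp add: field_simps)
      then have "n * int m = 1" by linarith
      then show False using \<open>m \<noteq> 1\<close> by (simp add: zmult_eq_1_iff)
    qed
    then show "\<exists>x\<in>carrier G. \<psi> x \<noteq> 1" using u by blast
  qed
qed

text \<open>
  A nontrivial zero would give a square root \<open>z\<close> of \<open>-1\<close>. The group of units has order \<open>4 k + 2\<close>, so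
  \<open>1 = z\<^bsup>4 k + 2\<^esup> = (-1)\<^bsup>2 k + 1\<^esup> = -1\<close>, which is impossible because the characteristic is not 2.
\<close>

lemma (in field) sum_of_squares_anisotropic:
  assumes q: "order R mod 4 = 3" and x: "x \<in> carrier R" and y: "y \<in> carrier R"
    and zero: "x \<otimes> x \<oplus> y \<otimes> y = \<zero>"
  shows "x = \<zero> \<and> y = \<zero>"
proof -
  have fin: "finite (carrier R)"
    using q by (metis card.infinite mod_0 order_def zero_neq_numeral)
  define k where "k = order R div 4"
  have k: "order R = 4 * k + 3" unfolding k_def using q by presburger
  \<comment> \<open>Otherwise \<open>order R\<close>, being odd, would act on \<open>\<one>\<close> as the identity, while it annihilates
    the additive group.\<close>
  have "\<one> \<oplus> \<one> \<noteq> \<zero>"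
  proof
    assume two: "\<one> \<oplus> \<one> = \<zero>"
    have double: "add_pow R (2 * n) \<one> = \<zero>" for n :: nat
      using two by (induction n) (simp_all add: a_assoc)
    have "add_pow R (4 * k + 3) \<one> = add_pow R (2 * (2 * k + 1)) \<one> \<oplus> \<one>"
      by (simp flip: add.nat_pow_Suc add: eval_nat_numeral add.assoc)
    also have "\<dots> = \<one>" by (simp only: double l_zero one_closed)
    also have "add_pow R (4 * k + 3) \<one> = \<zero>"
      using add.pow_order_eq_1[of \<one>] fin k by (simp add: order_def)
    ultimately show False by simp
  qed
  have no_root: "z \<otimes> z \<noteq> \<ominus> \<one>" if z: "z \<in> carrier R" for z
  proof
    assume root: "z \<otimes> z = \<ominus> \<one>"
    have "\<ominus> \<one> \<noteq> \<zero>" by (metis minus_minus minus_zero one_closed one_not_zero)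
    then have "z \<noteq> \<zero>" using root by (metis l_null zero_closed)
    then have "z \<in> Units R" using z by (simp add: field_Units)
    then have "z [^] card (Units R) = \<one>"
      using fin by (intro units_power_order_eq_one) (simp_all add: field_Units)
    moreover have "card (Units R) = order R - 1"
      using fin by (simp add: field_Units order_def)
    ultimately have "z [^] (order R - 1) = \<one>" by simp
    moreover have "z [^] (order R - 1) = (z [^] (2 :: nat)) [^] (2 * k + 1)"
      unfolding nat_pow_pow[OF z] k by (simp add: algebra_simps)
    moreover have "z [^] (2 :: nat) = \<ominus> \<one>" using root z by (simp add: numeral_2_eq_2)
    moreover have "(\<ominus> \<one>) [^] (2 * k + 1) = ((\<ominus> \<one>) [^] (2 :: nat)) [^] k \<otimes> \<ominus> \<one>"
      by (simp add: nat_pow_pow)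
    moreover have "(\<ominus> \<one>) [^] (2 :: nat) = \<one>" by (simp add: numeral_2_eq_2 l_minus r_minus)
    ultimately have "\<one> = \<ominus> \<one>" by simp
    then show False using \<open>\<one> \<oplus> \<one> \<noteq> \<zero>\<close> by (metis one_closed r_neg)
  qed
  have "y = \<zero>"
  proof (rule ccontr)
    assume "y \<noteq> \<zero>"
    then have y': "y \<in> Units R" using y by (simp add: field_Units)
    have "(x \<otimes> inv y) \<otimes> (x \<otimes> inv y) \<oplus> \<one> = (x \<otimes> x \<oplus> y \<otimes> y) \<otimes> (inv y \<otimes> inv y)"
    proof -
      have "(x \<otimes> x \<oplus> y \<otimes> y) \<otimes> (inv y \<otimes> inv y)
          = (x \<otimes> inv y) \<otimes> (x \<otimes> inv y) \<oplus> (y \<otimes> inv y) \<otimes> (y \<otimes> inv y)"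
        using x y Units_inv_closed[OF y'] by algebra
      then show ?thesis using y' by simp
    qed
    also have "\<dots> = \<zero>" using zero Units_inv_closed[OF y'] by simp
    finally have "(x \<otimes> inv y) \<otimes> (x \<otimes> inv y) = \<ominus> \<one>"
      using x Units_inv_closed[OF y'] by (intro minus_equality[symmetric]) auto
    then show False using no_root[of "x \<otimes> inv y"] x Units_inv_closed[OF y'] by simp
  qed
  then show ?thesis using zero x by (simp add: integral_iff)
qed

section \<open>The plane over a ring\<close>

definition vec_group :: "('a, 'b) ring_scheme \<Rightarrow> ('a ^ 'n) monoid" where
  "vec_group F = \<lparr>carrier = vec_carrier F, monoid.mult = vec_plus F, one = (\<chi> i. \<zero>\<^bsub>F\<^esub>)\<rparr>"

lemma vec_group_simps [simp]:
  "carrier (vec_group F) = vec_carrier F"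
  "x \<otimes>\<^bsub>vec_group F\<^esub> y = vec_plus F x y"
  "\<one>\<^bsub>vec_group F\<^esub> = (\<chi> i. \<zero>\<^bsub>F\<^esub>)"
  by (simp_all add: vec_group_def)

lemma (in abelian_monoid) vec_plus_closed:
  "x \<in> vec_carrier G \<Longrightarrow> y \<in> vec_carrier G \<Longrightarrow> vec_plus G x y \<in> vec_carrier G"
  by (simp add: vec_carrier_def vec_plus_def)

lemma (in abelian_group) vec_group: "comm_group (vec_group G)"
proof (rule comm_groupI)
  fix x :: "'a ^ 'n" assume x: "x \<in> carrier (vec_group G)"
  have "(\<chi> i. \<ominus> (x $ i)) \<in> vec_carrier G" "vec_plus G (\<chi> i. \<ominus> (x $ i)) x = (\<chi> i. \<zero>)"
    using x by (auto simp: vec_carrier_def vec_plus_def vec_eq_iff l_neg)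
  then show "\<exists>y\<in>carrier (vec_group G). y \<otimes>\<^bsub>vec_group G\<^esub> x = \<one>\<^bsub>vec_group G\<^esub>" by auto
qed (auto simp: vec_carrier_def vec_plus_def vec_eq_iff a_ac)

lemma bij_betw_vec_carrier2:
  "bij_betw (\<lambda>x :: 'a ^ 2. (x $ 1, x $ 2)) (vec_carrier F) (carrier F \<times> carrier F)"
proof (rule bij_betwI)
  show "(\<lambda>(a, b). \<chi> i. if i = 1 then a else b)
      \<in> carrier F \<times> carrier F \<rightarrow> (vec_carrier F :: ('a ^ 2) set)"
    by (auto simp: vec_carrier_def)
qed (auto simp: vec_carrier_def vec_eq_iff forall_2)

lemma card_vec_carrier2: "card (vec_carrier F :: ('a ^ 2) set) = (card (carrier F))\<^sup>2"
  using bij_betw_same_card[OF bij_betw_vec_carrier2[of F]]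
  by (simp add: card_cartesian_product power2_eq_square)

lemma finite_vec_carrier2: "finite (carrier F) \<Longrightarrow> finite (vec_carrier F :: ('a ^ 2) set)"
  using bij_betw_finite[OF bij_betw_vec_carrier2[of F]] by simp

lemma (in abelian_monoid) finsum_2:
  assumes "f 1 \<in> carrier G" "f 2 \<in> carrier G"
  shows "(\<Oplus>j\<in>(UNIV :: 2 set). f j) = f 1 \<oplus> f 2"
  using assms by (simp add: UNIV_2)

lemma finite_orthogonal_group2:
  assumes "finite (carrier F)"
  shows "finite (orthogonal_group2 F)"
proof (rule finite_subset)
  show "orthogonal_group2 F \<subseteq> (\<lambda>(x, y). \<chi> i. if i = 1 then x else y) ` (vec_carrier F \<times> vec_carrier F)"
  proof
    fix g assume "g \<in> orthogonal_group2 F"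
    then have "(g $ 1, g $ 2) \<in> vec_carrier F \<times> vec_carrier F"
      by (auto simp: orthogonal_group2_def mat_carrier_def vec_carrier_def)
    moreover have "g = (\<lambda>(x, y). \<chi> i. if i = 1 then x else y) (g $ 1, g $ 2)"
      by (simp add: vec_eq_iff forall_2)
    ultimately show "g \<in> (\<lambda>(x, y). \<chi> i. if i = 1 then x else y) ` (vec_carrier F \<times> vec_carrier F)"
      by (rule rev_image_eqI)
  qed
qed (simp add: finite_vec_carrier2 assms)

section \<open>Circles and orthogonal matrices in an anisotropic plane\<close>

text \<open>
  If \<open>a, b, c, d\<close> are points of one circle with \<open>a + b = c + d\<close>, adding up this identity over the
  coordinates shows that \<open>c - a\<close> is orthogonal to \<open>c - b\<close> if \<open>2 \<noteq> 0\<close>. Twice the product is written as a sum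
  to avoid numerals in \<open>R\<close>.
\<close>

lemma (in cring) parallelogram_identity:
  assumes "a \<in> carrier R" "b \<in> carrier R" "c \<in> carrier R" and d: "d = a \<oplus> b \<ominus> c"
  shows "(c \<ominus> a) \<otimes> (c \<ominus> b) \<oplus> (c \<ominus> a) \<otimes> (c \<ominus> b)
    = (d \<otimes> d \<ominus> a \<otimes> a) \<oplus> (c \<otimes> c \<ominus> b \<otimes> b)"
  unfolding d using assms(1-3) by algebra

text \<open>
  The coordinatewise reason why, in the same situation, \<open>c - a\<close> is orthogonal to \<open>a + b\<close> as well.
\<close>

lemma (in cring) difference_times_sum:
  assumes "a \<in> carrier R" "b \<in> carrier R" "c \<in> carrier R"
  shows "(c \<ominus> a) \<otimes> (a \<oplus> b) = (c \<otimes> c \<ominus> a \<otimes> a) \<ominus> (c \<ominus> a) \<otimes> (c \<ominus> b)"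
  using assms by algebra

lemma (in abelian_group) add_differences:
  assumes "p \<in> carrier G" "p' \<in> carrier G" "r \<in> carrier G" "r' \<in> carrier G"
  shows "(p \<ominus> r) \<oplus> (p' \<ominus> r') = (p \<oplus> p') \<ominus> (r \<oplus> r')"
  using assms by (simp add: a_minus_def minus_add a_ac)

context field
begin

abbreviation plane :: "('a ^ 2) set" where
  "plane \<equiv> vec_carrier R"

definition dot :: "'a ^ 2 \<Rightarrow> 'a ^ 2 \<Rightarrow> 'a" where
  "dot x y = x $ 1 \<otimes> y $ 1 \<oplus> x $ 2 \<otimes> y $ 2"

definition circle :: "'a \<Rightarrow> ('a ^ 2) set" where
  "circle t = {x \<in> plane. dot x x = t}"

lemma plane_nth [simp, intro]: "x \<in> plane \<Longrightarrow> x $ i \<in> carrier R"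
  by (simp add: vec_carrier_def)

lemma dot_closed [simp]: "x \<in> plane \<Longrightarrow> y \<in> plane \<Longrightarrow> dot x y \<in> carrier R"
  by (simp add: dot_def)

lemma orthogonal_group2_entries:
  assumes "g \<in> orthogonal_group2 R"
  shows "g $ i $ j \<in> carrier R"
    and "g $ 1 $ 1 \<otimes> g $ 1 $ 1 \<oplus> g $ 2 $ 1 \<otimes> g $ 2 $ 1 = \<one>"
    and "g $ 1 $ 1 \<otimes> g $ 1 $ 2 \<oplus> g $ 2 $ 1 \<otimes> g $ 2 $ 2 = \<zero>"
    and "g $ 1 $ 2 \<otimes> g $ 1 $ 2 \<oplus> g $ 2 $ 2 \<otimes> g $ 2 $ 2 = \<one>"
proof -
  have c: "g $ i $ j \<in> carrier R" for i j
    using assms by (simp add: orthogonal_group2_def mat_carrier_def)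
  then show "g $ i $ j \<in> carrier R" .
  have eq: "mat_mult R (Finite_Cartesian_Product.transpose g) g $ i $ k = mat_one R $ i $ k" for i k
    using assms by (simp add: orthogonal_group2_def)
  show "g $ 1 $ 1 \<otimes> g $ 1 $ 1 \<oplus> g $ 2 $ 1 \<otimes> g $ 2 $ 1 = \<one>"
    "g $ 1 $ 1 \<otimes> g $ 1 $ 2 \<oplus> g $ 2 $ 1 \<otimes> g $ 2 $ 2 = \<zero>"
    "g $ 1 $ 2 \<otimes> g $ 1 $ 2 \<oplus> g $ 2 $ 2 \<otimes> g $ 2 $ 2 = \<one>"
    using eq[of 1 1] eq[of 1 2] eq[of 2 2] c
    by (simp_all add: mat_mult_def mat_one_def Finite_Cartesian_Product.transpose_def finsum_2)
qed

lemma mat_vec_mult_2: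
  assumes "g \<in> mat_carrier R" "x \<in> plane"
  shows "mat_vec_mult R g x $ i = g $ i $ 1 \<otimes> x $ 1 \<oplus> g $ i $ 2 \<otimes> x $ 2"
  using assms by (simp add: mat_vec_mult_def mat_carrier_def finsum_2)

lemma mat_vec_mult_plane:
  assumes "g \<in> mat_carrier R" "x \<in> plane"
  shows "mat_vec_mult R g x \<in> plane"
proof -
  have c: "g $ i $ j \<in> carrier R" for i j using assms by (simp add: mat_carrier_def)
  have "mat_vec_mult R g x $ i \<in> carrier R" for i
    unfolding mat_vec_mult_2[OF assms] by (intro a_closed m_closed c plane_nth[OF assms(2)])
  then show ?thesis by (simp add: vec_carrier_def del: plane_nth)
qed

lemma transpose_mat_carrier:
  "g \<in> mat_carrier R \<Longrightarrow> Finite_Cartesian_Product.transpose g \<in> mat_carrier R"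
  by (simp add: mat_carrier_def Finite_Cartesian_Product.transpose_def)

lemma dot_transpose:
  assumes g: "g \<in> mat_carrier R" and x: "x \<in> plane" and y: "y \<in> plane"
  shows "dot (mat_vec_mult R g x) y = dot x (mat_vec_mult R (Finite_Cartesian_Product.transpose g) y)"
proof -
  have c: "g $ i $ j \<in> carrier R" for i j using g by (simp add: mat_carrier_def)
  have t: "Finite_Cartesian_Product.transpose g $ i $ j = g $ j $ i" for i j
    by (simp add: Finite_Cartesian_Product.transpose_def)
  show ?thesis
    unfolding dot_def mat_vec_mult_2[OF g x] mat_vec_mult_2[OF transpose_mat_carrier[OF g] y] t
    using c[of 1 1] c[of 1 2] c[of 2 1] c[of 2 2] plane_nth[OF x, of 1] plane_nth[OF x, of 2]
      plane_nth[OF y, of 1] plane_nth[OF y, of 2]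
    by algebra
qed

text \<open>
  The transpose is a left inverse.
\<close>

lemma orthogonal_inj_on:
  assumes g: "g \<in> orthogonal_group2 R"
  shows "inj_on (mat_vec_mult R g) plane"
proof (rule inj_on_inverseI)
  fix x assume x: "x \<in> plane"
  note G = orthogonal_group2_entries[OF g]
  have gm: "g \<in> mat_carrier R" using g by (simp add: orthogonal_group2_def)
  note c = G(1)[of 1 1] G(1)[of 1 2] G(1)[of 2 1] G(1)[of 2 2] plane_nth[OF x, of 1] plane_nth[OF x, of 2]
  have 1: "g $ 1 $ 1 \<otimes> (g $ 1 $ 1 \<otimes> x $ 1 \<oplus> g $ 1 $ 2 \<otimes> x $ 2)
      \<oplus> g $ 2 $ 1 \<otimes> (g $ 2 $ 1 \<otimes> x $ 1 \<oplus> g $ 2 $ 2 \<otimes> x $ 2) = x $ 1"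
  proof -
    have "g $ 1 $ 1 \<otimes> (g $ 1 $ 1 \<otimes> x $ 1 \<oplus> g $ 1 $ 2 \<otimes> x $ 2)
      \<oplus> g $ 2 $ 1 \<otimes> (g $ 2 $ 1 \<otimes> x $ 1 \<oplus> g $ 2 $ 2 \<otimes> x $ 2)
      = (g $ 1 $ 1 \<otimes> g $ 1 $ 1 \<oplus> g $ 2 $ 1 \<otimes> g $ 2 $ 1) \<otimes> x $ 1
        \<oplus> (g $ 1 $ 1 \<otimes> g $ 1 $ 2 \<oplus> g $ 2 $ 1 \<otimes> g $ 2 $ 2) \<otimes> x $ 2"
      using c by algebra
    then show ?thesis unfolding G(2,3) using c by simp
  qed
  have 2: "g $ 1 $ 2 \<otimes> (g $ 1 $ 1 \<otimes> x $ 1 \<oplus> g $ 1 $ 2 \<otimes> x $ 2)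
      \<oplus> g $ 2 $ 2 \<otimes> (g $ 2 $ 1 \<otimes> x $ 1 \<oplus> g $ 2 $ 2 \<otimes> x $ 2) = x $ 2"
  proof -
    have "g $ 1 $ 2 \<otimes> (g $ 1 $ 1 \<otimes> x $ 1 \<oplus> g $ 1 $ 2 \<otimes> x $ 2)
      \<oplus> g $ 2 $ 2 \<otimes> (g $ 2 $ 1 \<otimes> x $ 1 \<oplus> g $ 2 $ 2 \<otimes> x $ 2)
      = (g $ 1 $ 1 \<otimes> g $ 1 $ 2 \<oplus> g $ 2 $ 1 \<otimes> g $ 2 $ 2) \<otimes> x $ 1
        \<oplus> (g $ 1 $ 2 \<otimes> g $ 1 $ 2 \<oplus> g $ 2 $ 2 \<otimes> g $ 2 $ 2) \<otimes> x $ 2"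
      using c by algebra
    then show ?thesis unfolding G(3,4) using c by simp
  qed
  show "mat_vec_mult R (Finite_Cartesian_Product.transpose g) (mat_vec_mult R g x) = x"
    using 1 2 by (simp add: vec_eq_iff forall_2 mat_vec_mult_2 transpose_mat_carrier
        mat_vec_mult_plane gm x) (simp add: Finite_Cartesian_Product.transpose_def)
qed

text \<open>
  \<open>D\<close> is the determinant. The columns of \<open>g\<close> are orthonormal, so the second one is \<open>D\<close> times the
  first one turned by a right angle; this makes \<open>g\<close> depend on its first column and a sign only.
\<close>

lemma orthogonal_second_column:
  assumes g: "g \<in> orthogonal_group2 R"
  obtains D where "D \<in> {\<one>, \<ominus> \<one>}"
    "g $ 1 $ 2 = \<ominus> (D \<otimes> g $ 2 $ 1)" "g $ 2 $ 2 = D \<otimes> g $ 1 $ 1"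
proof -
  note G = orthogonal_group2_entries[OF g]
  define a where "a = g $ 1 $ 1"
  define b where "b = g $ 1 $ 2"
  define c where "c = g $ 2 $ 1"
  define d where "d = g $ 2 $ 2"
  have cl: "a \<in> carrier R" "b \<in> carrier R" "c \<in> carrier R" "d \<in> carrier R"
    unfolding a_def b_def c_def d_def by (rule G(1))+
  have E: "a \<otimes> a \<oplus> c \<otimes> c = \<one>" "a \<otimes> b \<oplus> c \<otimes> d = \<zero>" "b \<otimes> b \<oplus> d \<otimes> d = \<one>"
    unfolding a_def b_def c_def d_def by (rule G)+
  define D where "D = a \<otimes> d \<ominus> b \<otimes> c"
  have D: "D \<in> carrier R" unfolding D_def using cl by simp
  have d: "d = D \<otimes> a"
  proof -
    have "d \<otimes> (a \<otimes> a \<oplus> c \<otimes> c) = D \<otimes> a \<oplus> c \<otimes> (a \<otimes> b \<oplus> c \<otimes> d)"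
      unfolding D_def using cl by algebra
    then show ?thesis unfolding E using cl D by simp
  qed
  have b: "b = \<ominus> (D \<otimes> c)"
  proof -
    have "b \<otimes> (a \<otimes> a \<oplus> c \<otimes> c) = \<ominus> (D \<otimes> c) \<oplus> a \<otimes> (a \<otimes> b \<oplus> c \<otimes> d)"
      unfolding D_def using cl by algebra
    then show ?thesis unfolding E using cl D by simp
  qed
  have "(D \<ominus> \<one>) \<otimes> (D \<oplus> \<one>) = D \<otimes> D \<ominus> \<one>"
    using D by algebra
  also have "\<dots> = D \<otimes> D \<otimes> (a \<otimes> a \<oplus> c \<otimes> c) \<ominus> \<one>"
    unfolding E using D by simp
  also have "\<dots> = b \<otimes> b \<oplus> d \<otimes> d \<ominus> \<one>"
    unfolding b d using cl D by algebra
  finally have "(D \<ominus> \<one>) \<otimes> (D \<oplus> \<one>) = \<zero>"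
    unfolding E by (simp add: a_minus_def r_neg)
  then have "D \<ominus> \<one> = \<zero> \<or> D \<oplus> \<one> = \<zero>" using D by (simp add: integral_iff)
  then have "D \<in> {\<one>, \<ominus> \<one>}"
    using D by (metis insertCI minus_equality one_closed r_right_minus_eq)
  then show ?thesis using that b d unfolding a_def b_def c_def d_def by blast
qed

definition anisotropic :: bool where
  "anisotropic \<longleftrightarrow> (\<forall>x\<in>carrier R. \<forall>y\<in>carrier R. x \<otimes> x \<oplus> y \<otimes> y = \<zero> \<longrightarrow> x = \<zero> \<and> y = \<zero>)"

lemma anisotropicD:
  "\<lbrakk>anisotropic; x \<in> carrier R; y \<in> carrier R; x \<otimes> x \<oplus> y \<otimes> y = \<zero>\<rbrakk> \<Longrightarrow> x = \<zero> \<and> y = \<zero>"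
  unfolding anisotropic_def by blast

text \<open>
  In the plane two vectors orthogonal to the same nonzero vector are parallel. If they are orthogonal
  to each other too, then one of them is zero, since anisotropy excludes nonzero vectors orthogonal
  to themselves.
\<close>

lemma mutually_orthogonal_zero:
  assumes aniso: "anisotropic"
    and cl: "u \<in> carrier R" "u' \<in> carrier R" "v \<in> carrier R" "v' \<in> carrier R"
      "s \<in> carrier R" "s' \<in> carrier R"
    and uv: "u \<otimes> v \<oplus> u' \<otimes> v' = \<zero>"
    and us: "u \<otimes> s \<oplus> u' \<otimes> s' = \<zero>"
    and vs: "v \<otimes> s \<oplus> v' \<otimes> s' = \<zero>"
    and s: "s \<noteq> \<zero> \<or> s' \<noteq> \<zero>"
  shows "u = \<zero> \<and> u' = \<zero> \<or> v = \<zero> \<and> v' = \<zero>"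
proof -
  have "s \<otimes> (u \<otimes> v' \<ominus> u' \<otimes> v) = v' \<otimes> (u \<otimes> s \<oplus> u' \<otimes> s') \<ominus> u' \<otimes> (v \<otimes> s \<oplus> v' \<otimes> s')"
    using cl by algebra
  moreover have "s' \<otimes> (u \<otimes> v' \<ominus> u' \<otimes> v) = u \<otimes> (v \<otimes> s \<oplus> v' \<otimes> s') \<ominus> v \<otimes> (u \<otimes> s \<oplus> u' \<otimes> s')"
    using cl by algebra
  ultimately have "s \<otimes> (u \<otimes> v' \<ominus> u' \<otimes> v) = \<zero>" "s' \<otimes> (u \<otimes> v' \<ominus> u' \<otimes> v) = \<zero>"
    unfolding us vs using cl by (simp_all add: a_minus_def)
  \<comment> \<open>\<open>(u, u')\<close> and \<open>(v, v')\<close> are parallel.\<close>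
  then have det: "u \<otimes> v' \<ominus> u' \<otimes> v = \<zero>"
    using s cl by (auto simp: integral_iff)
  have "(u \<otimes> u \<oplus> u' \<otimes> u') \<otimes> v = u \<otimes> (u \<otimes> v \<oplus> u' \<otimes> v') \<ominus> u' \<otimes> (u \<otimes> v' \<ominus> u' \<otimes> v)"
    using cl by algebra
  moreover have "(u \<otimes> u \<oplus> u' \<otimes> u') \<otimes> v' = u' \<otimes> (u \<otimes> v \<oplus> u' \<otimes> v') \<oplus> u \<otimes> (u \<otimes> v' \<ominus> u' \<otimes> v)"
    using cl by algebra
  ultimately have "(u \<otimes> u \<oplus> u' \<otimes> u') \<otimes> v = \<zero>" "(u \<otimes> u \<oplus> u' \<otimes> u') \<otimes> v' = \<zero>"
    unfolding uv det using cl by (simp_all add: a_minus_def)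
  then have "u \<otimes> u \<oplus> u' \<otimes> u' = \<zero> \<or> v = \<zero> \<and> v' = \<zero>"
    using cl by (auto simp: integral_iff)
  then show ?thesis using anisotropicD[OF aniso cl(1,2)] by blast
qed

text \<open>
  Anisotropy excludes characteristic 2, where \<open>1\<^sup>2 + 1\<^sup>2 = 0\<close>.
\<close>

lemma anisotropic_two:
  assumes aniso: "anisotropic" and x: "x \<in> carrier R" and xx: "x \<oplus> x = \<zero>"
  shows "x = \<zero>"
proof -
  have "(\<one> \<oplus> \<one>) \<otimes> x = \<zero>" using x xx by (simp add: l_distr)
  moreover have "\<one> \<oplus> \<one> \<noteq> \<zero>" using anisotropicD[OF aniso one_closed one_closed] by auto
  ultimately show ?thesis using x by (simp add: integral_iff)
qed

text \<open>
  If \<open>a + b = c + d \<noteq> 0\<close>, the three vectors \<open>c - a\<close>, \<open>c - b\<close> and \<open>a + b\<close> are mutually orthogonal, and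
  in an anisotropic plane one of the first two must vanish: a rectangle inscribed in a circle
  has the centre as the midpoint of its diagonals.
\<close>

lemma circle_sidon:
  assumes aniso: "anisotropic"
  shows "sidon_off_one (vec_group R) (circle t)"
  unfolding sidon_off_one_def
proof (intro ballI impI)
  fix a b c d
  assume mem: "a \<in> circle t" "b \<in> circle t" "c \<in> circle t" "d \<in> circle t"
    and eq: "a \<otimes>\<^bsub>vec_group R\<^esub> b = c \<otimes>\<^bsub>vec_group R\<^esub> d"
    and ne: "a \<otimes>\<^bsub>vec_group R\<^esub> b \<noteq> \<one>\<^bsub>vec_group R\<^esub>"
  have cl [simp]: "a $ i \<in> carrier R" "b $ i \<in> carrier R" "c $ i \<in> carrier R" "d $ i \<in> carrier R" for i
    using mem by (auto simp: circle_def)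
  have t: "a $ 1 \<otimes> a $ 1 \<oplus> a $ 2 \<otimes> a $ 2 = t" "b $ 1 \<otimes> b $ 1 \<oplus> b $ 2 \<otimes> b $ 2 = t"
    "c $ 1 \<otimes> c $ 1 \<oplus> c $ 2 \<otimes> c $ 2 = t" "d $ 1 \<otimes> d $ 1 \<oplus> d $ 2 \<otimes> d $ 2 = t"
    using mem by (auto simp: circle_def dot_def)
  have tc: "t \<in> carrier R" unfolding t(1)[symmetric] by simp
  have d: "d $ i = a $ i \<oplus> b $ i \<ominus> c $ i" for i
  proof -
    have "a $ i \<oplus> b $ i = c $ i \<oplus> d $ i" using eq by (simp add: vec_plus_def vec_eq_iff)
    then have "a $ i \<oplus> b $ i \<ominus> c $ i = (c $ i \<oplus> d $ i) \<ominus> c $ i" by simp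
    also have "\<dots> = d $ i" using cl(3)[of i] cl(4)[of i] by algebra
    finally show ?thesis by simp
  qed
  define u where "u i = c $ i \<ominus> a $ i" for i
  define v where "v i = c $ i \<ominus> b $ i" for i
  define s where "s i = a $ i \<oplus> b $ i" for i
  have ucl: "u i \<in> carrier R" "v i \<in> carrier R" "s i \<in> carrier R" for i
    by (simp_all add: u_def v_def s_def)
  have uv: "u 1 \<otimes> v 1 \<oplus> u 2 \<otimes> v 2 = \<zero>"
  proof (rule anisotropic_two[OF aniso])
    have *: "u i \<otimes> v i \<oplus> u i \<otimes> v i
        = (d $ i \<otimes> d $ i \<ominus> a $ i \<otimes> a $ i) \<oplus> (c $ i \<otimes> c $ i \<ominus> b $ i \<otimes> b $ i)" for i
      unfolding u_def v_def by (rule parallelogram_identity) (simp_all add: d)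
    have "(u 1 \<otimes> v 1 \<oplus> u 2 \<otimes> v 2) \<oplus> (u 1 \<otimes> v 1 \<oplus> u 2 \<otimes> v 2)
        = (u 1 \<otimes> v 1 \<oplus> u 1 \<otimes> v 1) \<oplus> (u 2 \<otimes> v 2 \<oplus> u 2 \<otimes> v 2)"
      using ucl by (simp add: a_ac)
    also have "\<dots> = (d $ 1 \<otimes> d $ 1 \<oplus> d $ 2 \<otimes> d $ 2 \<ominus> (a $ 1 \<otimes> a $ 1 \<oplus> a $ 2 \<otimes> a $ 2))
        \<oplus> (c $ 1 \<otimes> c $ 1 \<oplus> c $ 2 \<otimes> c $ 2 \<ominus> (b $ 1 \<otimes> b $ 1 \<oplus> b $ 2 \<otimes> b $ 2))"
      unfolding * by (simp add: a_minus_def minus_add a_ac)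
    also have "\<dots> = \<zero>" unfolding t using tc by (simp add: a_minus_def r_neg)
    finally show "(u 1 \<otimes> v 1 \<oplus> u 2 \<otimes> v 2) \<oplus> (u 1 \<otimes> v 1 \<oplus> u 2 \<otimes> v 2) = \<zero>" .
  qed (simp add: ucl)
  have "u i \<otimes> s i = (c $ i \<otimes> c $ i \<ominus> a $ i \<otimes> a $ i) \<ominus> u i \<otimes> v i" for i
    using difference_times_sum[of "a $ i" "b $ i" "c $ i"]
    by (simp add: u_def v_def s_def m_comm a_comm)
  then have "u 1 \<otimes> s 1 \<oplus> u 2 \<otimes> s 2
      = (c $ 1 \<otimes> c $ 1 \<oplus> c $ 2 \<otimes> c $ 2 \<ominus> (a $ 1 \<otimes> a $ 1 \<oplus> a $ 2 \<otimes> a $ 2))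
        \<ominus> (u 1 \<otimes> v 1 \<oplus> u 2 \<otimes> v 2)"
    by (simp add: add_differences ucl)
  then have us: "u 1 \<otimes> s 1 \<oplus> u 2 \<otimes> s 2 = \<zero>"
    unfolding t uv using tc by (simp add: a_minus_def r_neg)
  have "v i \<otimes> s i = (c $ i \<otimes> c $ i \<ominus> b $ i \<otimes> b $ i) \<ominus> u i \<otimes> v i" for i
    using difference_times_sum[of "b $ i" "a $ i" "c $ i"]
    by (simp add: u_def v_def s_def m_comm a_comm)
  then have "v 1 \<otimes> s 1 \<oplus> v 2 \<otimes> s 2
      = (c $ 1 \<otimes> c $ 1 \<oplus> c $ 2 \<otimes> c $ 2 \<ominus> (b $ 1 \<otimes> b $ 1 \<oplus> b $ 2 \<otimes> b $ 2))
        \<ominus> (u 1 \<otimes> v 1 \<oplus> u 2 \<otimes> v 2)"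
    by (simp add: add_differences ucl)
  then have vs: "v 1 \<otimes> s 1 \<oplus> v 2 \<otimes> s 2 = \<zero>"
    unfolding t uv using tc by (simp add: a_minus_def r_neg)
  have "s 1 \<noteq> \<zero> \<or> s 2 \<noteq> \<zero>"
    using ne by (auto simp: s_def vec_plus_def vec_eq_iff forall_2)
  then have "u 1 = \<zero> \<and> u 2 = \<zero> \<or> v 1 = \<zero> \<and> v 2 = \<zero>"
    using mutually_orthogonal_zero[OF aniso, of "u 1" "u 2" "v 1" "v 2" "s 1" "s 2"] ucl uv us vs
    by blast
  then show "c = a \<or> c = b"
    by (auto simp: u_def v_def vec_eq_iff forall_2)
qed

text \<open>
  Besides preserving \<open>dot\<close>, the action on a single vector \<open>x\<close> nearly determines \<open>g\<close>: for either sign \<open>D\<close>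
  of the determinant, the coordinates of \<open>g\<^sup>T x\<close> depend linearly on the first column of \<open>g\<close>,
  and the last two equations solve for that column.
\<close>

lemma orthogonal_transpose:
  assumes g: "g \<in> orthogonal_group2 R" and x: "x \<in> plane"
  defines "y \<equiv> mat_vec_mult R (Finite_Cartesian_Product.transpose g) x"
  shows orthogonal_transpose_circle: "y \<in> circle (dot x x)"
    and orthogonal_transpose_determines:
      "\<exists>D\<in>{\<one>, \<ominus> \<one>}. g $ 1 $ 2 = \<ominus> (D \<otimes> g $ 2 $ 1) \<and> g $ 2 $ 2 = D \<otimes> g $ 1 $ 1 \<and>
         g $ 1 $ 1 \<otimes> dot x x = x $ 1 \<otimes> y $ 1 \<oplus> x $ 2 \<otimes> (D \<otimes> y $ 2) \<and>
         g $ 2 $ 1 \<otimes> dot x x = x $ 2 \<otimes> y $ 1 \<ominus> x $ 1 \<otimes> (D \<otimes> y $ 2)"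
proof -
  have gm: "g \<in> mat_carrier R" using g by (simp add: orthogonal_group2_def)
  obtain D where D: "D \<in> {\<one>, \<ominus> \<one>}"
    and col: "g $ 1 $ 2 = \<ominus> (D \<otimes> g $ 2 $ 1)" "g $ 2 $ 2 = D \<otimes> g $ 1 $ 1"
    using orthogonal_second_column[OF g] .
  have Dc: "D \<in> carrier R" and DD: "D \<otimes> D = \<one>" using D by (auto simp: l_minus r_minus)
  note G = orthogonal_group2_entries[OF g]
  define a where "a = g $ 1 $ 1"
  define c where "c = g $ 2 $ 1"
  have cl: "a \<in> carrier R" "c \<in> carrier R" "x $ 1 \<in> carrier R" "x $ 2 \<in> carrier R"
    using G(1) x by (auto simp: a_def c_def)
  have y: "y $ 1 = a \<otimes> x $ 1 \<oplus> c \<otimes> x $ 2" "y $ 2 = D \<otimes> (a \<otimes> x $ 2 \<ominus> c \<otimes> x $ 1)"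
  proof -
    have y_nth: "y $ i = g $ 1 $ i \<otimes> x $ 1 \<oplus> g $ 2 $ i \<otimes> x $ 2" for i
      unfolding y_def mat_vec_mult_2[OF transpose_mat_carrier[OF gm] x]
      by (simp add: Finite_Cartesian_Product.transpose_def)
    show "y $ 1 = a \<otimes> x $ 1 \<oplus> c \<otimes> x $ 2" unfolding y_nth a_def c_def ..
    show "y $ 2 = D \<otimes> (a \<otimes> x $ 2 \<ominus> c \<otimes> x $ 1)"
      unfolding y_nth col a_def[symmetric] c_def[symmetric] using cl Dc by algebra
  qed
  have sq: "(D \<otimes> w) \<otimes> (D \<otimes> w) = (D \<otimes> D) \<otimes> (w \<otimes> w)" if "w \<in> carrier R" for w
    using Dc that by (simp add: m_ac)
  have "dot y y = (a \<otimes> x $ 1 \<oplus> c \<otimes> x $ 2) \<otimes> (a \<otimes> x $ 1 \<oplus> c \<otimes> x $ 2)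
      \<oplus> (D \<otimes> D) \<otimes> ((a \<otimes> x $ 2 \<ominus> c \<otimes> x $ 1) \<otimes> (a \<otimes> x $ 2 \<ominus> c \<otimes> x $ 1))"
    unfolding dot_def y using cl by (simp only: sq minus_closed m_closed)
  also have "\<dots> = (a \<otimes> x $ 1 \<oplus> c \<otimes> x $ 2) \<otimes> (a \<otimes> x $ 1 \<oplus> c \<otimes> x $ 2)
      \<oplus> (a \<otimes> x $ 2 \<ominus> c \<otimes> x $ 1) \<otimes> (a \<otimes> x $ 2 \<ominus> c \<otimes> x $ 1)"
    unfolding DD using cl by simp
  also have "\<dots> = (a \<otimes> a \<oplus> c \<otimes> c) \<otimes> dot x x"
    unfolding dot_def using cl by algebra
  also have "\<dots> = dot x x" unfolding a_def c_def G(2) using x by simp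
  finally show "y \<in> circle (dot x x)"
    unfolding circle_def y_def using mat_vec_mult_plane[OF transpose_mat_carrier[OF gm] x] by simp
  have "x $ 1 \<otimes> y $ 1 \<oplus> x $ 2 \<otimes> (D \<otimes> y $ 2)
      = x $ 1 \<otimes> (a \<otimes> x $ 1 \<oplus> c \<otimes> x $ 2) \<oplus> (D \<otimes> D) \<otimes> (x $ 2 \<otimes> (a \<otimes> x $ 2 \<ominus> c \<otimes> x $ 1))"
    unfolding y using cl Dc by algebra
  also have "\<dots> = x $ 1 \<otimes> (a \<otimes> x $ 1 \<oplus> c \<otimes> x $ 2) \<oplus> x $ 2 \<otimes> (a \<otimes> x $ 2 \<ominus> c \<otimes> x $ 1)"
    unfolding DD using cl by simp
  also have "\<dots> = a \<otimes> dot x x" unfolding dot_def using cl by algebra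
  finally have 1: "a \<otimes> dot x x = x $ 1 \<otimes> y $ 1 \<oplus> x $ 2 \<otimes> (D \<otimes> y $ 2)" ..
  have "x $ 2 \<otimes> y $ 1 \<ominus> x $ 1 \<otimes> (D \<otimes> y $ 2)
      = x $ 2 \<otimes> (a \<otimes> x $ 1 \<oplus> c \<otimes> x $ 2) \<ominus> (D \<otimes> D) \<otimes> (x $ 1 \<otimes> (a \<otimes> x $ 2 \<ominus> c \<otimes> x $ 1))"
    unfolding y using cl Dc by algebra
  also have "\<dots> = x $ 2 \<otimes> (a \<otimes> x $ 1 \<oplus> c \<otimes> x $ 2) \<ominus> x $ 1 \<otimes> (a \<otimes> x $ 2 \<ominus> c \<otimes> x $ 1)"
    unfolding DD using cl by simp
  also have "\<dots> = c \<otimes> dot x x" unfolding dot_def using cl by algebra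
  finally have 2: "c \<otimes> dot x x = x $ 2 \<otimes> y $ 1 \<ominus> x $ 1 \<otimes> (D \<otimes> y $ 2)" ..
  show "\<exists>D\<in>{\<one>, \<ominus> \<one>}. g $ 1 $ 2 = \<ominus> (D \<otimes> g $ 2 $ 1) \<and> g $ 2 $ 2 = D \<otimes> g $ 1 $ 1 \<and>
         g $ 1 $ 1 \<otimes> dot x x = x $ 1 \<otimes> y $ 1 \<oplus> x $ 2 \<otimes> (D \<otimes> y $ 2) \<and>
         g $ 2 $ 1 \<otimes> dot x x = x $ 2 \<otimes> y $ 1 \<ominus> x $ 1 \<otimes> (D \<otimes> y $ 2)"
    using D col 1 2 unfolding a_def c_def by blast
qed

text \<open>
  At most one \<open>g\<close> for each value of the determinant.
\<close>

lemma card_orthogonal_fibre_le_2: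
  assumes fin: "finite (carrier R)" and x: "x \<in> plane" and x0: "dot x x \<noteq> \<zero>"
  shows "card {g \<in> orthogonal_group2 R. mat_vec_mult R (Finite_Cartesian_Product.transpose g) x = y} \<le> 2"
proof -
  define S where "S D = {g \<in> orthogonal_group2 R.
      g $ 1 $ 2 = \<ominus> (D \<otimes> g $ 2 $ 1) \<and> g $ 2 $ 2 = D \<otimes> g $ 1 $ 1 \<and>
      g $ 1 $ 1 \<otimes> dot x x = x $ 1 \<otimes> y $ 1 \<oplus> x $ 2 \<otimes> (D \<otimes> y $ 2) \<and>
      g $ 2 $ 1 \<otimes> dot x x = x $ 2 \<otimes> y $ 1 \<ominus> x $ 1 \<otimes> (D \<otimes> y $ 2)}" for D
  have finS: "finite (S D)" for D
    unfolding S_def using finite_orthogonal_group2[OF fin] by simp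
  have S1: "card (S D) \<le> 1" for D
  proof -
    have "g = h" if g: "g \<in> S D" and h: "h \<in> S D" for g h
    proof -
      have "g $ 1 $ 1 \<otimes> dot x x = h $ 1 $ 1 \<otimes> dot x x" "g $ 2 $ 1 \<otimes> dot x x = h $ 2 $ 1 \<otimes> dot x x"
        using g h unfolding S_def by auto
      moreover have "g $ i $ j \<in> carrier R" "h $ i $ j \<in> carrier R" for i j
        using g h orthogonal_group2_entries(1) unfolding S_def by blast+
      ultimately have "g $ 1 $ 1 = h $ 1 $ 1" "g $ 2 $ 1 = h $ 2 $ 1"
        using x x0 by (simp_all add: m_rcancel)
      then show "g = h"
        using g h unfolding S_def by (simp add: vec_eq_iff forall_2)
    qed
    then show ?thesis using finS[of D] by (simp add: card_le_Suc0_iff_eq)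
  qed
  have "{g \<in> orthogonal_group2 R. mat_vec_mult R (Finite_Cartesian_Product.transpose g) x = y}
      \<subseteq> S \<one> \<union> S (\<ominus> \<one>)"
    using orthogonal_transpose_determines[OF _ x] unfolding S_def by fastforce
  then have "card {g \<in> orthogonal_group2 R. mat_vec_mult R (Finite_Cartesian_Product.transpose g) x = y}
      \<le> card (S \<one> \<union> S (\<ominus> \<one>))"
    using finS by (intro card_mono) auto
  also have "\<dots> \<le> card (S \<one>) + card (S (\<ominus> \<one>))" by (rule card_Un_le)
  finally show ?thesis using S1[of \<one>] S1[of "\<ominus> \<one>"] by linarith
qed

lemma finite_circle: "finite (carrier R) \<Longrightarrow> finite (circle t)"
  unfolding circle_def by (rule finite_subset[OF _ finite_vec_carrier2]) auto

lemma sum_orthogonal_orbit_le: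
  fixes f :: "'a ^ 2 \<Rightarrow> real"
  assumes fin: "finite (carrier R)" and x: "x \<in> plane" and x0: "dot x x \<noteq> \<zero>" and f: "\<And>y. f y \<ge> 0"
  shows "(\<Sum>g\<in>orthogonal_group2 R. f (mat_vec_mult R (Finite_Cartesian_Product.transpose g) x))
    \<le> 2 * (\<Sum>y\<in>circle (dot x x). f y)"
proof -
  define T where "T g = mat_vec_mult R (Finite_Cartesian_Product.transpose g) x" for g :: "'a ^ 2 ^ 2"
  have "(\<Sum>g\<in>orthogonal_group2 R. f (T g))
      = (\<Sum>y\<in>circle (dot x x). \<Sum>g\<in>{g \<in> orthogonal_group2 R. T g = y}. f (T g))"
    using finite_orthogonal_group2[OF fin] finite_circle[OF fin] orthogonal_transpose_circle[OF _ x]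
    by (intro sum.group[symmetric]) (auto simp: T_def)
  also have "\<dots> = (\<Sum>y\<in>circle (dot x x). card {g \<in> orthogonal_group2 R. T g = y} * f y)"
    by (intro sum.cong refl) simp
  also have "\<dots> \<le> (\<Sum>y\<in>circle (dot x x). 2 * f y)"
    using card_orthogonal_fibre_le_2[OF fin x x0] f
    by (intro sum_mono mult_right_mono) (auto simp: T_def)
  finally show ?thesis unfolding T_def by (simp add: sum_distrib_left)
qed

section \<open>The variance over all rigid motions\<close>

text \<open>
  A single nontrivial additive character \<open>\<psi>\<close> of the field suffices: if \<open>x\<close> has a nonzero coordinate,
  then \<open>dot x y\<close> takes every value as \<open>y\<close> varies, including one at which \<open>\<psi>\<close> is not 1.
\<close>

lemma plane_self_dual:
  assumes fin: "finite (carrier R)"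
  obtains \<psi> :: "'a \<Rightarrow> complex" where "self_dual_group (vec_group R) (\<lambda>x y. \<psi> (dot x y))"
proof -
  have nonzero: "carrier R \<noteq> {\<zero>}" using one_closed one_not_zero by blast
  obtain \<psi> :: "'a \<Rightarrow> complex" where
    mult: "\<forall>x\<in>carrier R. \<forall>y\<in>carrier R. \<psi> (x \<oplus> y) = \<psi> x * \<psi> y"
    and norm: "\<forall>x\<in>carrier R. cmod (\<psi> x) = 1"
    and nontriv: "\<exists>x\<in>carrier R. \<psi> x \<noteq> 1"
    using comm_group.nontrivial_character_exists[OF a_comm_group, simplified, OF fin nonzero]
    by (elim exE conjE) (rule that)
  interpret V: comm_group "vec_group R :: ('a ^ 2) monoid" by (rule vec_group)
  have "self_dual_group (vec_group R) (\<lambda>x y. \<psi> (dot x y))"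
  proof
    show "finite (carrier (vec_group R :: ('a ^ 2) monoid))" using finite_vec_carrier2[OF fin] by simp
  next
    fix x y z :: "'a ^ 2"
    assume "x \<in> carrier (vec_group R)" "y \<in> carrier (vec_group R)" "z \<in> carrier (vec_group R)"
    then have xyz: "x \<in> plane" "y \<in> plane" "z \<in> plane" by simp_all
    have "dot (vec_plus R x y) z = dot x z \<oplus> dot y z"
      unfolding dot_def vec_plus_def vec_lambda_beta
      using xyz[THEN plane_nth, of 1] xyz[THEN plane_nth, of 2] by algebra
    then show "\<psi> (dot (x \<otimes>\<^bsub>vec_group R\<^esub> y) z) = \<psi> (dot x z) * \<psi> (dot y z)"
      using mult xyz by simp
  next
    fix x y :: "'a ^ 2"
    assume "x \<in> carrier (vec_group R)" "y \<in> carrier (vec_group R)"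
    then have xy: "x \<in> plane" "y \<in> plane" by simp_all
    have "dot x y = dot y x" unfolding dot_def using xy by (simp add: m_comm)
    then show "\<psi> (dot x y) = \<psi> (dot y x)" by simp
    show "cmod (\<psi> (dot x y)) = 1" using norm xy by simp
  next
    fix x :: "'a ^ 2"
    assume "x \<in> carrier (vec_group R)" and "x \<noteq> \<one>\<^bsub>vec_group R\<^esub>"
    then have x: "x \<in> plane" and "\<exists>i. x $ i \<noteq> \<zero>" by (simp_all add: vec_eq_iff)
    then obtain i where i: "x $ i \<noteq> \<zero>" by blast
    obtain u where u: "u \<in> carrier R" "\<psi> u \<noteq> 1" using nontriv by blast
    define y :: "'a ^ 2" where "y = (\<chi> j. if j = i then inv (x $ i) \<otimes> u else \<zero>)"
    have xi: "x $ i \<in> Units R" using x i by (simp add: field_Units)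
    then have y: "y \<in> plane" using u by (simp add: y_def vec_carrier_def del: plane_nth)
    have "x $ i \<otimes> (inv (x $ i) \<otimes> u) = u"
      using xi u x by (simp flip: m_assoc)
    then have "dot x y = u"
      using x u xi exhaust_2[of i] by (auto simp: dot_def y_def)
    then show "\<exists>y\<in>carrier (vec_group R). \<psi> (dot x y) \<noteq> 1" using y u by auto
  qed
  then show ?thesis by (rule that)
qed

lemma dot_self_nonzero:
  assumes "anisotropic" and x: "x \<in> plane" and "x \<noteq> (\<chi> i. \<zero>)"
  shows "dot x x \<noteq> \<zero>"
  using assms anisotropicD[of "x $ 1" "x $ 2"] by (auto simp: dot_def vec_eq_iff forall_2)

text \<open>
  Since \<open>fourier (g ` A) \<xi> = fourier A (g\<^sup>T \<xi>)\<close>, the variance for one rotation is a weighted sum over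
  frequencies \<open>\<xi>\<close>, and summing over the rotations replaces the factor of \<open>A\<close> by its \<open>L\<^sup>2\<close> mass on the
  circle through \<open>\<xi>\<close>. Restriction bounds that mass uniformly in \<open>\<xi>\<close>, and Parseval sums the
  remaining factor of \<open>B\<close>.
\<close>

lemma motions_variance:
  assumes fin: "finite (carrier R)" and aniso: "anisotropic" and A: "A \<subseteq> plane" and B: "B \<subseteq> plane"
  shows "(\<Sum>g\<in>orthogonal_group2 R. \<Sum>z\<in>plane.
      (card {y \<in> mat_vec_mult R g ` A. vec_plus R y z \<in> B}
        - card A * card B / (real (order R))\<^sup>2)\<^sup>2)
    \<le> 2 * real (order R) * sqrt (3 * real (card A) ^ 3) * card B"
proof -
  obtain \<psi> :: "'a \<Rightarrow> complex" where "self_dual_group (vec_group R) (\<lambda>x y. \<psi> (dot x y))"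
    using plane_self_dual[OF fin] .
  then interpret V: self_dual_group "vec_group R" "\<lambda>x y. \<psi> (dot x y)" .
  let ?O = "orthogonal_group2 R"
  let ?T = "\<lambda>g. mat_vec_mult R (Finite_Cartesian_Product.transpose g)"
  let ?P = "plane - {\<chi> i. \<zero>}"
  define q where "q = real (order R)"
  define M where "M = sqrt (3 * real (card A) ^ 3)"
  have q: "q > 0" unfolding q_def using fin zero_closed by (auto simp: order_def card_gt_0_iff)
  have order: "real (order (vec_group R :: ('a ^ 2) monoid)) = q\<^sup>2"
    by (simp add: order_def card_vec_carrier2 q_def)
  have finO: "finite ?O" by (rule finite_orthogonal_group2[OF fin])
  have one_rotation: "(\<Sum>z\<in>plane. (card {y \<in> mat_vec_mult R g ` A. vec_plus R y z \<in> B}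
        - card A * card B / q\<^sup>2)\<^sup>2)
      = (\<Sum>\<xi>\<in>?P. (cmod (V.fourier A (?T g \<xi>)))\<^sup>2 * (cmod (V.fourier B \<xi>))\<^sup>2) / q\<^sup>2"
    if g: "g \<in> ?O" for g
  proof -
    have gm: "g \<in> mat_carrier R" using g by (simp add: orthogonal_group2_def)
    have inj: "inj_on (mat_vec_mult R g) A"
      using orthogonal_inj_on[OF g] A by (rule inj_on_subset)
    have sub: "mat_vec_mult R g ` A \<subseteq> plane" using mat_vec_mult_plane[OF gm] A by auto
    have "V.fourier (mat_vec_mult R g ` A) \<xi> = V.fourier A (?T g \<xi>)" if "\<xi> \<in> plane" for \<xi>
      unfolding V.fourier_def using inj A that
      by (auto simp: sum.reindex dot_transpose[OF gm] intro!: sum.cong)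
    then show ?thesis
      using V.translate_variance[of "mat_vec_mult R g ` A" B] sub B
      by (simp add: card_image[OF inj] order)
  qed
  have rotations: "(\<Sum>g\<in>?O. (cmod (V.fourier A (?T g \<xi>)))\<^sup>2) \<le> 2 * (q * M)" if \<xi>: "\<xi> \<in> ?P" for \<xi>
  proof -
    have "(\<Sum>\<eta>\<in>circle (dot \<xi> \<xi>). (cmod (V.fourier A \<eta>))\<^sup>2)\<^sup>2 \<le> 3 * q\<^sup>2 * real (card A) ^ 3"
      using V.restriction_L2[of A "circle (dot \<xi> \<xi>)"] A circle_sidon[OF aniso]
      by (auto simp: circle_def order)
    also have "\<dots> = (q * M)\<^sup>2"
      unfolding M_def by (simp add: power_mult_distrib)
    finally have "(\<Sum>\<eta>\<in>circle (dot \<xi> \<xi>). (cmod (V.fourier A \<eta>))\<^sup>2) \<le> q * M"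
      by (rule power2_le_imp_le) (use q in \<open>simp add: M_def\<close>)
    moreover have "(\<Sum>g\<in>?O. (cmod (V.fourier A (?T g \<xi>)))\<^sup>2)
        \<le> 2 * (\<Sum>\<eta>\<in>circle (dot \<xi> \<xi>). (cmod (V.fourier A \<eta>))\<^sup>2)"
      using \<xi> dot_self_nonzero[OF aniso] by (intro sum_orthogonal_orbit_le fin) auto
    ultimately show ?thesis by linarith
  qed
  have "(\<Sum>g\<in>?O. \<Sum>z\<in>plane. (card {y \<in> mat_vec_mult R g ` A. vec_plus R y z \<in> B}
        - card A * card B / q\<^sup>2)\<^sup>2)
      = (\<Sum>g\<in>?O. \<Sum>\<xi>\<in>?P. (cmod (V.fourier A (?T g \<xi>)))\<^sup>2 * (cmod (V.fourier B \<xi>))\<^sup>2) / q\<^sup>2"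
    unfolding sum_divide_distrib[where A = ?O] by (intro sum.cong refl one_rotation)
  also have "(\<Sum>g\<in>?O. \<Sum>\<xi>\<in>?P. (cmod (V.fourier A (?T g \<xi>)))\<^sup>2 * (cmod (V.fourier B \<xi>))\<^sup>2)
      = (\<Sum>\<xi>\<in>?P. (\<Sum>g\<in>?O. (cmod (V.fourier A (?T g \<xi>)))\<^sup>2) * (cmod (V.fourier B \<xi>))\<^sup>2)"
    unfolding sum_distrib_right by (rule sum.swap)
  also have "\<dots> / q\<^sup>2 \<le> (\<Sum>\<xi>\<in>?P. 2 * (q * M) * (cmod (V.fourier B \<xi>))\<^sup>2) / q\<^sup>2"
    by (intro divide_right_mono sum_mono mult_right_mono rotations) auto
  also have "\<dots> \<le> (\<Sum>\<xi>\<in>plane. 2 * (q * M) * (cmod (V.fourier B \<xi>))\<^sup>2) / q\<^sup>2"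
    using finite_vec_carrier2[OF fin] q by (intro divide_right_mono sum_mono2) (auto simp: M_def)
  also have "\<dots> = 2 * (q * M) * (q\<^sup>2 * card B) / q\<^sup>2"
    using V.parseval[of B] B order by (simp flip: sum_distrib_left)
  also have "\<dots> = 2 * q * M * card B" using q by simp
  finally show ?thesis unfolding q_def M_def .
qed

end

section \<open>Growth under rigid motions\<close>

theorem theorem1p11:
  shows "\<exists>c::real. c > 0 \<and>
    (\<forall>(q::nat) (F::nat ring) (A::(nat ^ 2) set) (R::((nat ^ 2 ^ 2) \<times> (nat ^ 2)) set).
       primepow q \<longrightarrow> q mod 4 = 3 \<longrightarrow>
       field F \<longrightarrow> card (carrier F) = q \<longrightarrow>
       A \<subseteq> vec_carrier F \<longrightarrow> R \<subseteq> rigid_motions2 F \<longrightarrow>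
       real (card (\<Union>r\<in>R. motion_map F r ` A))
         \<ge> c * min ((real q)\<^sup>2) (sqrt (real (card A)) * real (card R) / real q))"
proof (intro exI[of _ "1/14"] conjI allI impI)
  fix q :: nat and F :: "nat ring" and A :: "(nat ^ 2) set" and R :: "((nat ^ 2 ^ 2) \<times> (nat ^ 2)) set"
  assume q4: "q mod 4 = 3" and "field F" and cardF: "card (carrier F) = q"
    and A: "A \<subseteq> vec_carrier F" and R: "R \<subseteq> rigid_motions2 F"
  interpret field F by fact
  have q0: "q > 0" using q4 by (cases q) auto
  have fin: "finite (carrier F)" using cardF q0 card_gt_0_iff by blast
  have orderF: "order F = q" using cardF by (simp add: order_def)
  have aniso: "anisotropic"
    unfolding anisotropic_def using sum_of_squares_anisotropic q4 orderF by blast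
  define B where "B = (\<Union>r\<in>R. motion_map F r ` A)"
  define n where "n = real (card A)"
  have finA: "finite A" using A finite_vec_carrier2[OF fin] finite_subset by blast
  have finM: "finite (rigid_motions2 F)"
    unfolding rigid_motions2_def
    using finite_orthogonal_group2[OF fin] finite_vec_carrier2[OF fin] by blast
  have motion: "motion_map F r x = vec_plus F (mat_vec_mult F (fst r) x) (snd r)" for r x
    by (simp add: motion_map_def)
  have gm: "fst r \<in> mat_carrier F" "fst r \<in> orthogonal_group2 F" "snd r \<in> vec_carrier F"
    if "r \<in> R" for r using that R by (auto simp: rigid_motions2_def orthogonal_group2_def)
  have B: "B \<subseteq> vec_carrier F"
  proof -
    have "motion_map F r x \<in> vec_carrier F" if "r \<in> R" "x \<in> A" for r x
      unfolding motion using that gm A by (intro vec_plus_closed mat_vec_mult_plane) auto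
    then show ?thesis unfolding B_def by blast
  qed
  show "real (card (\<Union>r\<in>R. motion_map F r ` A))
      \<ge> 1 / 14 * min ((real q)\<^sup>2) (sqrt (real (card A)) * real (card R) / real q)"
    unfolding B_def[symmetric] n_def[symmetric]
  proof (cases "2 * real (card B) \<ge> (real q)\<^sup>2 \<or> n = 0")
    case True
    then show "1 / 14 * min ((real q)\<^sup>2) (sqrt n * real (card R) / real q) \<le> real (card B)"
      by (auto simp: min_def)
  next
    case False
    then have B_small: "2 * real (card B) < (real q)\<^sup>2" and n: "n > 0" by (auto simp: n_def)
    let ?dev = "\<lambda>g z. (card {y \<in> mat_vec_mult F g ` A. vec_plus F y z \<in> B}
        - card A * card B / (real q)\<^sup>2)\<^sup>2"
    \<comment> \<open>All of \<open>A\<close> lands in \<open>B\<close>, where fewer than \<open>n / 2\<close> points would be the average.\<close>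
    have "card R * (n / 2)\<^sup>2 = (\<Sum>r\<in>R. (n / 2)\<^sup>2)" by simp
    also have "\<dots> \<le> (\<Sum>r\<in>R. ?dev (fst r) (snd r))"
    proof (rule sum_mono)
      fix r assume r: "r \<in> R"
      have "{y \<in> mat_vec_mult F (fst r) ` A. vec_plus F y (snd r) \<in> B} = mat_vec_mult F (fst r) ` A"
        using r unfolding B_def motion by auto
      then have "card {y \<in> mat_vec_mult F (fst r) ` A. vec_plus F y (snd r) \<in> B} = card A"
        using card_image[OF inj_on_subset[OF orthogonal_inj_on[OF gm(2)[OF r]] A]] by simp
      moreover have "n / 2 \<le> n - n * card B / (real q)\<^sup>2"
        using B_small n q0 by (simp add: field_simps)
      ultimately show "(n / 2)\<^sup>2 \<le> ?dev (fst r) (snd r)"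
        using n by (simp add: n_def power_mono)
    qed
    also have "\<dots> \<le> (\<Sum>r\<in>rigid_motions2 F. ?dev (fst r) (snd r))"
      using R finM by (intro sum_mono2) auto
    also have "\<dots> = (\<Sum>g\<in>orthogonal_group2 F. \<Sum>z\<in>vec_carrier F. ?dev g z)"
      unfolding rigid_motions2_def by (simp add: sum.cartesian_product case_prod_beta)
    also have "\<dots> \<le> 2 * real q * sqrt (3 * n ^ 3) * card B"
      using motions_variance[OF fin aniso A B] unfolding orderF n_def .
    also have "sqrt (3 * n ^ 3) = sqrt 3 * n * sqrt n"
      using n by (simp add: power3_eq_cube real_sqrt_mult)
    \<comment> \<open>The rational bound \<open>7 / 4\<close> for \<open>sqrt 3\<close> leads to the constant \<open>1 / 14\<close>:
      \<open>4 * 2 * 7 / 4 = 14\<close>.\<close>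
    also have "2 * real q * (sqrt 3 * n * sqrt n) * card B \<le> 2 * real q * (7 / 4 * n * sqrt n) * card B"
    proof -
      have "sqrt 3 \<le> 7 / 4" by (rule real_le_lsqrt) (auto simp: power2_eq_square)
      then show ?thesis using n by (intro mult_right_mono mult_left_mono) auto
    qed
    finally have le: "card R * (n / 2)\<^sup>2 \<le> 2 * real q * (7 / 4 * n * sqrt n) * card B" .
    have "(n * sqrt n) * (sqrt n * card R) = n * (sqrt n * sqrt n) * card R"
      by (simp only: mult_ac)
    also have "\<dots> = 4 * (card R * (n / 2)\<^sup>2)"
      using n by (simp add: power2_eq_square)
    also have "\<dots> \<le> 4 * (2 * real q * (7 / 4 * n * sqrt n) * card B)"
      using le by (rule mult_left_mono) simp
    also have "\<dots> = (n * sqrt n) * (14 * real q * card B)"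
      by (simp add: algebra_simps)
    finally have "(n * sqrt n) * (sqrt n * card R) \<le> (n * sqrt n) * (14 * real q * card B)" .
    then have "sqrt n * card R \<le> 14 * real q * card B"
      by (rule mult_left_le_imp_le) (use n in simp)
    then have "sqrt n * real (card R) / real q \<le> 14 * card B"
      using q0 by (simp add: field_simps)
    then show "1 / 14 * min ((real q)\<^sup>2) (sqrt n * real (card R) / real q) \<le> real (card B)"
      by linarith
  qed
qed simp

end
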